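(* Let $n\ge 1$ and let $BPM_n:\{0,1\}^{n^2}\to\{0,1\}$ be the function with $BPM_n(x_{1,1},\dots,x_{n,n})=1$ iff the bipartite graph on left vertices $\{1,\dots,n\}$ and right vertices $\{1,\dots,n\}$ with edge set $\{(i,j): x_{i,j}=1\}$ has a perfect matching. Then the unique multilinear polynomial over $\mathbb{R}$ representing $BPM_n$ is \[BPM_n(x_{1,1},\dots,x_{n,n})=\sum_{G\subseteq K_{n,n}} a_G\prod_{(i,j)\in E(G)}x_{i,j},\qquad a_G=\begin{cases}0 & \text{if } G \text{ is not matching-covered},\\ (-1)^{\chi(G)} & \text{if } G\text{ is matching-covered.}\end{cases}\]
   Context: Graphs $G\subseteq K_{n,n}$ are spanning subgraphs of the complete bipartite graph $K_{n,n}$ (all $2n$ vertices present), identified with their edge sets. $G$ is matching-covered if its edge set is the union of the edge sets of a nonempty collection of perfect matchings of $K_{n,n}$. The cyclomatic number is $\chi(G)=|E(G)|-|V(G)|+|C(G)|$, where $|C(G)|$ is the number of connected components of $G$ (isolated vertices counting as components). *)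

theory Defs
  imports Complex_Main "HOL-Library.Poly_Mapping" "HOL-Library.FuncSet"
begin

text \<open>
  Left and right vertices of \<open>K\<^sub>n\<^sub>,\<^sub>n\<close> are tagged \<open>Inl i\<close> and \<open>Inr j\<close>.  A spanning subgraph is
  identified with its edge set, where the pair \<open>(i, j)\<close> is the edge between \<open>Inl i\<close> and \<open>Inr j\<close>.
\<close>

type_synonym vertex = "nat + nat"
type_synonym edge = "nat \<times> nat"

definition verts :: "nat \<Rightarrow> vertex set" where
  "verts n = Inl ` {1..n} \<union> Inr ` {1..n}"

definition Knn :: "nat \<Rightarrow> edge set" where
  "Knn n = {1..n} \<times> {1..n}"

definition ends :: "edge \<Rightarrow> vertex set" where
  "ends e = {Inl (fst e), Inr (snd e)}"

definition perfect_matching :: "nat \<Rightarrow> edge set \<Rightarrow> bool" where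
  "perfect_matching n M \<longleftrightarrow> M \<subseteq> Knn n \<and> (\<forall>v\<in>verts n. \<exists>!e. e \<in> M \<and> v \<in> ends e)"

definition has_perfect_matching :: "nat \<Rightarrow> edge set \<Rightarrow> bool" where
  "has_perfect_matching n G \<longleftrightarrow> (\<exists>M\<subseteq>G. perfect_matching n M)"

definition matching_covered :: "nat \<Rightarrow> edge set \<Rightarrow> bool" where
  "matching_covered n G \<longleftrightarrow>
     (\<exists>\<M>. \<M> \<noteq> {} \<and> (\<forall>M\<in>\<M>. perfect_matching n M) \<and> G = \<Union>\<M>)"

definition adjacency :: "edge set \<Rightarrow> (vertex \<times> vertex) set" where
  "adjacency G = {(u, v). \<exists>e\<in>G. ends e = {u, v}}"

definition components :: "nat \<Rightarrow> edge set \<Rightarrow> vertex set set" where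
  "components n G = verts n // ((adjacency G)\<^sup>* \<inter> verts n \<times> verts n)"

definition cyclomatic :: "nat \<Rightarrow> edge set \<Rightarrow> int" where
  "cyclomatic n G = int (card G) - int (card (verts n)) + int (card (components n G))"

definition bpm_coeff :: "nat \<Rightarrow> edge set \<Rightarrow> real" where
  "bpm_coeff n G = (if matching_covered n G then (-1) powi cyclomatic n G else 0)"

definition cube :: "nat \<Rightarrow> (edge \<Rightarrow> real) set" where
  "cube n = Knn n \<rightarrow>\<^sub>E {0, 1}"

definition BPM :: "nat \<Rightarrow> (edge \<Rightarrow> real) \<Rightarrow> real" where
  "BPM n x = (if has_perfect_matching n {e \<in> Knn n. x e = 1} then 1 else 0)"

text \<open>
  Real polynomials in variables indexed by \<open>'v\<close>: finitely supported coefficient functions on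
  monomials, a monomial being a finitely supported exponent function.  The ring operations are
  those of the convolution product on \<^typ>\<open>('v \<Rightarrow>\<^sub>0 nat) \<Rightarrow>\<^sub>0 real\<close>.
\<close>

type_synonym 'v rpoly = "('v \<Rightarrow>\<^sub>0 nat) \<Rightarrow>\<^sub>0 real"

definition Const :: "real \<Rightarrow> 'v rpoly" where
  "Const c = Poly_Mapping.single 0 c"

definition Var :: "'v \<Rightarrow> 'v rpoly" where
  "Var v = Poly_Mapping.single (Poly_Mapping.single v 1) 1"

definition eval_poly :: "'v rpoly \<Rightarrow> ('v \<Rightarrow> real) \<Rightarrow> real" where
  "eval_poly p x = (\<Sum>m\<in>Poly_Mapping.keys p.
     Poly_Mapping.lookup p m * (\<Prod>v\<in>Poly_Mapping.keys m. x v ^ Poly_Mapping.lookup m v))"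

definition multilinear_in :: "'v set \<Rightarrow> 'v rpoly \<Rightarrow> bool" where
  "multilinear_in V p \<longleftrightarrow> (\<forall>m\<in>Poly_Mapping.keys p.
     Poly_Mapping.keys m \<subseteq> V \<and> (\<forall>v. Poly_Mapping.lookup m v \<le> 1))"

definition represents_on :: "('v \<Rightarrow> real) set \<Rightarrow> 'v rpoly \<Rightarrow> (('v \<Rightarrow> real) \<Rightarrow> real) \<Rightarrow> bool" where
  "represents_on X p f \<longleftrightarrow> (\<forall>x\<in>X. eval_poly p x = f x)"

end

theory Submission
  imports Defs "HOL-Library.Function_Algebras" "HOL-Library.Indicator_Function"
begin

text \<open>
  By Moebius inversion the claim is that the signs \<open>(-1)\<^bsup>\<chi>(H)\<^esup>\<close> of the matching-covered subgraphs \<open>H\<close>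
  of a graph \<open>G\<close> with a perfect matching add up to \<open>1\<close>. Consider the cone of nonnegative edge weightings
  of \<open>G\<close> for which all vertices have the same weighted degree. By Hall's theorem the supports of its nonzero
  points are exactly the matching-covered subgraphs of \<open>G\<close>, so these index the nonzero faces of the cone, and
  the face of \<open>H\<close> has dimension \<open>\<chi>(H) + 1\<close>. The claim is then Euler's relation for a pointed cone,
  which is proved by cutting the faces into cells and cancelling the cells in pairs along a direction
  of the cone.
\<close>

section \<open>Euler's relation for polyhedral cones\<close>

text \<open>The cone is the cone over the face of the Birkhoff polytope cut out by \<open>G\<close>.
  Using the cone keeps every dimension that of a linear subspace; the summand 1 in
  \<open>chi(H) + 1\<close> is the freedom in the common degree. The zero face has sign +1, so the
  relation reads 1 + sum of (-1)^(chi(H) + 1) = 0, which is the claim. The obstacle is that faces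
  cannot be paired directly: adding a vector \<open>v\<close> of the cone makes every weight
  positive where \<open>v\<close> is positive, and so erases which of these weights vanished.
  Cutting the faces by comparisons of the weights scaled by \<open>v\<close> restores this
  information, and the signed count of cells does not change under such cuts. The indicator of any
  perfect matching in \<open>G\<close> can serve as \<open>v\<close>; if \<open>G\<close> has no
  perfect matching, the cone is {0} and offers no direction.\<close>

lemma dim_kernel_functional:
  fixes S :: "'a::real_vector set" and g :: "'a \<Rightarrow> real"
  assumes S: "subspace S" and fin: "finite B" "S \<subseteq> span B"
    and g: "linear g" and z: "z \<in> S" "g z \<noteq> 0"
  shows "dim S = Suc (dim {x \<in> S. g x = 0})"
proof -
  define K where "K = {x \<in> S. g x = 0}"
  have K: "subspace K"
    using S g by (auto simp: K_def subspace_def linear_add linear_0 linear_cmul)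
  obtain D where D: "D \<subseteq> K" "independent D" "K \<subseteq> span D" "card D = dim K"
    using basis_exists by blast
  have spD: "span D = K"
    using D K by (metis span_minimal subset_antisym)
  \<comment> \<open>An infinite basis would have \<open>card\<close> 0. The edge weightings form an
    infinite-dimensional space, hence the finite spanning set \<open>B\<close>.\<close>
  have "finite D"
    using independent_span_bound[OF fin(1) D(2)] D(1) fin(2) by (auto simp: K_def)
  have "z \<notin> span D"
    using z spD by (auto simp: K_def)
  then have ind: "independent (insert z D)" and "z \<notin> D"
    using D(2) by (auto simp: independent_insert intro: span_base)
  have "S \<subseteq> span (insert z D)"
  proof
    fix x assume "x \<in> S"
    then have "x - (g x / g z) *\<^sub>R z \<in> K"
      using S g z by (auto simp: K_def subspace_diff subspace_scale linear_diff linear_cmul)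
    then show "x \<in> span (insert z D)"
      unfolding span_insert using spD by auto
  qed
  moreover have "insert z D \<subseteq> S"
    using D(1) z by (auto simp: K_def)
  ultimately have "dim S = card (insert z D)"
    using ind by (metis dim_eq_card_independent dim_span span_mono span_span subset_antisym dim_unique)
  then show ?thesis
    using \<open>finite D\<close> \<open>z \<notin> D\<close> D(4) by (simp add: K_def)
qed

text \<open>With the value 0 off the finite set \<open>F\<close> there are only finitely many sign
  vectors, and forgetting a functional \<open>g\<close> is the update
  \<open>s(g := 0)\<close>.\<close>

definition sgn_vec :: "('a \<Rightarrow> real) set \<Rightarrow> 'a \<Rightarrow> ('a \<Rightarrow> real) \<Rightarrow> real" where
  "sgn_vec F x = (\<lambda>f. if f \<in> F then sgn (f x) else 0)"

definition cell_span :: "'a set \<Rightarrow> ('a \<Rightarrow> real) set \<Rightarrow> (('a \<Rightarrow> real) \<Rightarrow> real) \<Rightarrow> 'a set" where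
  "cell_span W F s = {y \<in> W. \<forall>f\<in>F. s f = 0 \<longrightarrow> f y = 0}"

text \<open>The combinatorial Euler characteristic of a union \<open>A\<close> of cells of the arrangement \<open>F\<close> in the
  subspace \<open>W\<close>. A cell is represented by its sign vector and is open in its \<open>cell_span\<close>.\<close>

definition cell_sum :: "'a::real_vector set \<Rightarrow> ('a \<Rightarrow> real) set \<Rightarrow> 'a set \<Rightarrow> int" where
  "cell_sum W F A = (\<Sum>s\<in>sgn_vec F ` A. (-1) ^ dim (cell_span W F s))"

lemma finite_sgn_vec_image: "finite F \<Longrightarrow> finite (sgn_vec F ` A)"
  by (rule finite_subset[OF _ finite_set_of_finite_funs[of F "{-1, 0, 1}" 0]])
    (auto simp: sgn_vec_def sgn_real_def split: if_splits)

lemma sgn_vec_eq_iff: "sgn_vec F x = sgn_vec F y \<longleftrightarrow> (\<forall>f\<in>F. sgn (f x) = sgn (f y))"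
  by (auto simp: sgn_vec_def fun_eq_iff)

lemma subspace_cell_span:
  assumes "subspace W" "\<And>f. f \<in> F \<Longrightarrow> linear f"
  shows "subspace (cell_span W F s)"
  using assms by (auto simp: cell_span_def subspace_def linear_add linear_0 linear_cmul)

lemma sgn_add_small:
  fixes a b :: real
  assumes "a \<noteq> 0"
  shows "\<exists>d>0. \<forall>t. \<bar>t\<bar> < d \<longrightarrow> sgn (a + t * b) = sgn a"
\<comment> \<open>The 1 in the denominator keeps the bound positive when
  \<open>b = 0\<close>.\<close>
proof (intro exI[of _ "\<bar>a\<bar> / (\<bar>b\<bar> + 1)"] conjI allI impI)
  fix t :: real assume "\<bar>t\<bar> < \<bar>a\<bar> / (\<bar>b\<bar> + 1)"
  then have "\<bar>t\<bar> * (\<bar>b\<bar> + 1) < \<bar>a\<bar>"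
    by (simp add: field_simps)
  then have "\<bar>t * b\<bar> < \<bar>a\<bar>"
    by (simp add: abs_mult algebra_simps)
  then show "sgn (a + t * b) = sgn a"
    by (auto simp: sgn_real_def)
qed (use assms in \<open>auto simp: add_nonneg_pos\<close>)

text \<open>This is why cells are closed under positive combinations.\<close>

lemma sgn_pos_combination:
  fixes a b u w :: real
  assumes "a > 0" "b > 0" "sgn u = sgn w"
  shows "sgn (a * u + b * w) = sgn w"
proof (rule linorder_cases[of u 0])
  assume "u = 0"
  then have "w = 0" using assms(3) by (metis sgn_0_0)
  with \<open>u = 0\<close> show ?thesis by simp
next
  assume "u > 0"
  then have "w > 0" using assms(3) by (metis sgn_greater)
  with \<open>u > 0\<close> show ?thesis using assms by (simp add: add_pos_pos)
next
  assume "u < 0"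
  then have "w < 0" using assms(3) by (metis sgn_less)
  with \<open>u < 0\<close> show ?thesis using assms by (simp add: add_neg_neg mult_pos_neg)
qed

text \<open>Functionals that vanish at \<open>x\<close> also vanish at \<open>z\<close> and stay
  zero along the line; the finitely many others keep their sign for small \<open>t\<close>.\<close>

lemma cell_open_in_span:
  assumes "finite F" "\<And>f. f \<in> F \<Longrightarrow> linear f" "z \<in> cell_span W F (sgn_vec F x)"
  shows "\<exists>d>0. \<forall>t. \<bar>t\<bar> < d \<longrightarrow> sgn_vec F (x + t *\<^sub>R z) = sgn_vec F x"
  using assms
proof (induction F)
  case empty
  show ?case by (intro exI[of _ 1]) (auto simp: sgn_vec_def)
next
  case (insert f F)
  from insert obtain d where d: "d > 0" "\<And>t. \<bar>t\<bar> < d \<Longrightarrow> sgn_vec F (x + t *\<^sub>R z) = sgn_vec F x"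
    by (force simp: cell_span_def sgn_vec_def)
  have f: "f (x + t *\<^sub>R z) = f x + t * f z" for t
    using insert.prems(1)[of f] by (simp add: linear_add linear_cmul)
  have "\<exists>d>0. \<forall>t. \<bar>t\<bar> < d \<longrightarrow> sgn (f (x + t *\<^sub>R z)) = sgn (f x)"
  proof (cases "f x = 0")
    case True
    then have "f z = 0" using insert.prems(2) by (auto simp: cell_span_def sgn_vec_def)
    with True show ?thesis by (intro exI[of _ 1]) (simp add: f)
  next
    case False
    then show ?thesis unfolding f by (rule sgn_add_small)
  qed
  then obtain d' where d': "d' > 0" "\<And>t. \<bar>t\<bar> < d' \<Longrightarrow> sgn (f (x + t *\<^sub>R z)) = sgn (f x)"
    by blast
  show ?case
    using d d' by (intro exI[of _ "min d d'"]) (auto simp: sgn_vec_eq_iff)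
qed

text \<open>A cell of dimension \<open>k\<close> on which \<open>g\<close> takes both signs is replaced by cells of dimensions
  \<open>k\<close>, \<open>k - 1\<close>, \<open>k\<close>; every other cell survives unchanged.\<close>

lemma cell_sum_insert:
  assumes W: "subspace W" "finite B" "W \<subseteq> span B"
    and F: "finite F" "\<And>f. f \<in> F \<Longrightarrow> linear f" and g: "linear g" "g \<notin> F"
    and A: "A \<subseteq> W" "\<And>x y. x \<in> A \<Longrightarrow> y \<in> W \<Longrightarrow> sgn_vec F y = sgn_vec F x \<Longrightarrow> y \<in> A"
  shows "cell_sum W (insert g F) A = cell_sum W F A"
proof -
  \<comment> \<open>The fibre of \<open>r\<close> over \<open>s\<close> consists of the pieces into
    which \<open>g\<close> cuts the cell of \<open>s\<close>; below, \<open>Q\<close> is this cell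
    and \<open>S\<close> its linear hull.\<close>
  define r where "r s = s(g := (0::real))" for s :: "('a \<Rightarrow> real) \<Rightarrow> real"
  let ?w = "\<lambda>s. (-1::int) ^ dim (cell_span W (insert g F) s)"
  let ?V = "sgn_vec (insert g F) ` A"
  have r: "r (sgn_vec (insert g F) x) = sgn_vec F x" for x
    using g(2) by (intro ext) (auto simp: r_def sgn_vec_def)
  have upd: "sgn_vec (insert g F) x = (sgn_vec F x)(g := sgn (g x))" for x
    by (intro ext) (auto simp: sgn_vec_def)
  have "cell_sum W (insert g F) A = (\<Sum>s\<in>r ` ?V. \<Sum>s'\<in>{s'\<in>?V. r s' = s}. ?w s')"
    unfolding cell_sum_def by (rule sum.image_gen) (simp add: finite_sgn_vec_image F(1))
  also have "r ` ?V = sgn_vec F ` A"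
    by (auto simp: image_image r)
  also have "(\<Sum>s\<in>sgn_vec F ` A. \<Sum>s'\<in>{s'\<in>?V. r s' = s}. ?w s') = cell_sum W F A"
    unfolding cell_sum_def
  proof (rule sum.cong[OF refl])
    fix s assume "s \<in> sgn_vec F ` A"
    then obtain x where x: "x \<in> A" "s = sgn_vec F x" by blast
    define Q where "Q = {y \<in> W. sgn_vec F y = s}"
    define S where "S = cell_span W F s"
    have S: "subspace S" unfolding S_def by (rule subspace_cell_span) (use W F in auto)
    have SW: "S \<subseteq> W" by (auto simp: S_def cell_span_def)
    have xQ: "x \<in> Q" using x A(1) by (auto simp: Q_def)
    have QS: "Q \<subseteq> S"
      by (auto simp: Q_def S_def cell_span_def sgn_vec_def sgn_0_0)
    have "{s'\<in>?V. r s' = s} = (\<lambda>y. s(g := sgn (g y))) ` Q"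
    proof (intro set_eqI iffI)
      fix s' assume "s' \<in> {s'\<in>?V. r s' = s}"
      then obtain y where "y \<in> A" "s' = sgn_vec (insert g F) y" "sgn_vec F y = s"
        using r by auto
      then show "s' \<in> (\<lambda>y. s(g := sgn (g y))) ` Q"
        using A(1) upd by (auto simp: Q_def)
    next
      fix s' assume "s' \<in> (\<lambda>y. s(g := sgn (g y))) ` Q"
      then obtain y where y: "y \<in> W" "sgn_vec F y = s" "s' = s(g := sgn (g y))"
        by (auto simp: Q_def)
      then have "y \<in> A" using A(2) x by metis
      moreover have "s' = sgn_vec (insert g F) y" using upd y by simp
      ultimately show "s' \<in> {s'\<in>?V. r s' = s}" using r y by auto
    qed
    also have "\<dots> = (\<lambda>a. s(g := a)) ` ((\<lambda>y. sgn (g y)) ` Q)"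
      by (simp add: image_image)
    finally have eq: "{s'\<in>?V. r s' = s} = (\<lambda>a. s(g := a)) ` ((\<lambda>y. sgn (g y)) ` Q)" .
    have sp: "cell_span W (insert g F) (s(g := a)) = (if a = 0 then {y\<in>S. g y = 0} else S)" for a
      using g(2) by (auto simp: cell_span_def S_def)
    have "(\<Sum>s'\<in>{s'\<in>?V. r s' = s}. ?w s') =
        (\<Sum>a\<in>(\<lambda>y. sgn (g y)) ` Q. (-1) ^ dim (if a = 0 then {y\<in>S. g y = 0} else S))"
      unfolding eq by (subst sum.reindex) (auto simp: inj_on_def sp dest: fun_upd_eqD)
    also have "\<dots> = (-1) ^ dim S"
    proof (cases "\<forall>y\<in>S. g y = 0")
      case True
      then have "(\<lambda>y. sgn (g y)) ` Q = {0}" using QS xQ by force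
      moreover have "{y\<in>S. g y = 0} = S" using True by auto
      ultimately show ?thesis by simp
    next
      case False
      then obtain z where z: "z \<in> S" "g z \<noteq> 0" by blast
      have dimS: "dim S = Suc (dim {y\<in>S. g y = 0})"
        by (rule dim_kernel_functional[OF S W(2) _ g(1) z]) (use SW W in auto)
      show ?thesis
      proof (cases "\<exists>y\<in>Q. g y = 0")
        case True
        then obtain y where y: "y \<in> Q" "g y = 0" by blast
        \<comment> \<open>The cell is open in \<open>S\<close>, so a short segment through the zero
          \<open>y\<close> of \<open>g\<close> in direction \<open>z\<close> stays inside it and
          meets both signs of \<open>g\<close>.\<close>
        have "z \<in> cell_span W F (sgn_vec F y)" using y z by (simp add: Q_def S_def)
        from cell_open_in_span[OF F this] obtain d where d: "d > 0"
          "\<And>t. \<bar>t\<bar> < d \<Longrightarrow> sgn_vec F (y + t *\<^sub>R z) = sgn_vec F y" by blast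
        have mem: "y + t *\<^sub>R z \<in> Q" if "\<bar>t\<bar> < d" for t
          using d(2)[OF that] y z SW W(1) by (auto simp: Q_def intro!: subspace_add subspace_scale)
        have val: "sgn (g (y + t *\<^sub>R z)) = sgn t * sgn (g z)" for t
          using g y by (simp add: linear_add linear_cmul sgn_mult)
        have "sgn (g z) \<in> (\<lambda>y. sgn (g y)) ` Q"
          using mem[of "d/2"] val[of "d/2"] d(1) by (intro image_eqI) auto
        moreover have "- sgn (g z) \<in> (\<lambda>y. sgn (g y)) ` Q"
          using mem[of "-d/2"] val[of "-d/2"] d(1) by (intro image_eqI) auto
        moreover have "0 \<in> (\<lambda>y. sgn (g y)) ` Q" using y by force
        moreover have "(\<lambda>y. sgn (g y)) ` Q \<subseteq> {-1,0,1}" by (auto simp: sgn_real_def)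
        ultimately have "(\<lambda>y. sgn (g y)) ` Q = {-1,0,1}"
          using z(2) by (auto simp: sgn_real_def split: if_splits)
        then show ?thesis using dimS by simp
      next
        case False
        have "sgn (g y) = sgn (g x)" if "y \<in> Q" for y
        proof (rule ccontr)
          assume ne: "sgn (g y) \<noteq> sgn (g x)"
          have nz: "g x \<noteq> 0" "g y \<noteq> 0" using False xQ that by auto
          \<comment> \<open>These weights cancel \<open>g\<close>, whose values at \<open>x\<close>
            and \<open>y\<close> have opposite signs. By convexity the combination stays in
            \<open>Q\<close>, where \<open>g\<close> has no zero.\<close>
          define a where "a = \<bar>g y\<bar>"
          define b where "b = \<bar>g x\<bar>"
          have ab: "a > 0" "b > 0" using nz by (auto simp: a_def b_def)
          have "a *\<^sub>R x + b *\<^sub>R y \<in> Q"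
          proof -
            have "sgn (f (a *\<^sub>R x + b *\<^sub>R y)) = sgn (f x)" if "f \<in> F" for f
            proof -
              have "sgn (f x) = sgn (f y)"
                using that \<open>y \<in> Q\<close> xQ by (metis (mono_tags, lifting) Q_def mem_Collect_eq sgn_vec_eq_iff)
              moreover have "f (a *\<^sub>R x + b *\<^sub>R y) = a * f x + b * f y"
                using F(2)[OF that] by (simp add: linear_add linear_cmul)
              ultimately show ?thesis
                using ab by (simp add: sgn_pos_combination)
            qed
            then show ?thesis
              using that xQ W(1) sgn_vec_eq_iff[of F _ x]
              by (auto simp: Q_def intro!: subspace_add subspace_scale)
          qed
          moreover have "g (a *\<^sub>R x + b *\<^sub>R y) = 0"
            using g ne nz by (auto simp: linear_add linear_cmul a_def b_def sgn_real_def split: if_splits)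
          ultimately show False using False by blast
        qed
        then have "(\<lambda>y. sgn (g y)) ` Q = {sgn (g x)}" using xQ by blast
        moreover have "sgn (g x) \<noteq> 0" using False xQ by (auto simp: sgn_0_0)
        ultimately show ?thesis by simp
      qed
    qed
    finally show "(\<Sum>s'\<in>{s'\<in>?V. r s' = s}. ?w s') = (-1) ^ dim (cell_span W F s)"
      by (simp add: S_def)
  qed
  finally show ?thesis .
qed

lemma cell_sum_union:
  assumes W: "subspace W" "finite B" "W \<subseteq> span B"
    and F: "finite F" "\<And>f. f \<in> F \<Longrightarrow> linear f" and G: "finite G" "\<And>f. f \<in> G \<Longrightarrow> linear f"
    and A: "A \<subseteq> W" "\<And>x y. x \<in> A \<Longrightarrow> y \<in> W \<Longrightarrow> sgn_vec F y = sgn_vec F x \<Longrightarrow> y \<in> A"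
  shows "cell_sum W (G \<union> F) A = cell_sum W F A"
  using G
proof (induction G)
  case (insert g G)
  show ?case
  proof (cases "g \<in> G \<union> F")
    case True
    then show ?thesis using insert by (simp add: insert_absorb)
  next
    case False
    have "cell_sum W (insert g (G \<union> F)) A = cell_sum W (G \<union> F) A"
    proof (rule cell_sum_insert[OF W])
      show "y \<in> A" if "x \<in> A" "y \<in> W" "sgn_vec (G \<union> F) y = sgn_vec (G \<union> F) x" for x y
        using that A(2)[of x y] by (simp add: sgn_vec_eq_iff)
    qed (use insert False F A in auto)
    then show ?thesis using insert by simp
  qed
qed simp

text \<open>After refining by the functionals \<open>f(x) g(v) - g(x) f(v)\<close>, which are invariant under translation
  by \<open>v\<close>, the cells on the part of the boundary where some \<open>f\<close> with \<open>f(v) > 0\<close> vanishes are matched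
  with the remaining cells by \<open>x \<mapsto> x + v\<close>, which raises the dimension by one.\<close>

lemma cell_sum_cone:
  assumes W: "subspace W" "finite B" "W \<subseteq> span B"
    and F: "finite F" "\<And>f. f \<in> F \<Longrightarrow> linear f"
    and v: "v \<in> W" "\<And>f. f \<in> F \<Longrightarrow> f v \<ge> 0" and f1: "f1 \<in> F" "f1 v > 0"
  shows "cell_sum W F {x \<in> W. \<forall>f\<in>F. f x \<ge> 0} = 0"
proof -
  define C where "C = {x \<in> W. \<forall>f\<in>F. f x \<ge> 0}"
  define P where "P = {f \<in> F. f v > 0}"
  \<comment> \<open>For \<open>f\<close>, \<open>g\<close> in \<open>P\<close> the sign of
    \<open>d f g x\<close> compares \<open>f x / f v\<close> with \<open>g x / g v\<close>, the
    times at which \<open>f\<close> and \<open>g\<close> reach 0 when \<open>x\<close> moves along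
    \<open>- v\<close>.\<close>
  define d where "d f g = (\<lambda>x. f x * g v - g x * f v)" for f g :: "'a \<Rightarrow> real"
  define D where "D = (\<lambda>(f, g). d f g) ` (P \<times> P)"
  define T where "T = D \<union> F"
  have finP: "finite P" and PT: "P \<subseteq> T" using F by (auto simp: P_def T_def)
  have finT: "finite T" using F finP by (auto simp: T_def D_def)
  have linD: "linear (d f g)" if "f \<in> P" "g \<in> P" for f g
  proof -
    have "linear f" "linear g" using that F by (auto simp: P_def)
    then show ?thesis
      unfolding d_def by (intro linearI) (auto simp: linear_add linear_cmul algebra_simps)
  qed
  have linT: "linear f" if "f \<in> T" for f
    using that linD F by (auto simp: T_def D_def)
  have Tv: "f v = 0" if "f \<in> T" "f \<notin> P" for f
    using that v(2) by (force simp: T_def D_def P_def d_def)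
  have Pv: "f v > 0" if "f \<in> P" for f using that by (simp add: P_def)
  have dT: "d f g \<in> T" if "f \<in> P" "g \<in> P" for f g using that by (auto simp: T_def D_def)
  have dnP: "d f g \<notin> P" for f g by (auto simp: P_def d_def)
  have "cell_sum W F C = cell_sum W T C"
    unfolding T_def
  proof (rule cell_sum_union[symmetric, OF W F])
    show "y \<in> C" if "x \<in> C" "y \<in> W" "sgn_vec F y = sgn_vec F x" for x y
    proof -
      have "f y \<ge> 0" if "f \<in> F" for f
      proof -
        have "sgn (f y) = sgn (f x)" "f x \<ge> 0"
          using \<open>x \<in> C\<close> \<open>sgn_vec F y = sgn_vec F x\<close> that by (auto simp: sgn_vec_eq_iff C_def)
        then show ?thesis by (auto simp: sgn_real_def split: if_splits)
      qed
      then show ?thesis using that by (auto simp: C_def)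
    qed
  qed (use finP linD in \<open>auto simp: D_def C_def\<close>)
  also have "\<dots> = 0"
  proof -
    define C0 where "C0 = {x \<in> C. \<exists>f\<in>P. f x = 0}"
    \<comment> \<open>The effect of \<open>x + v\<close> on sign vectors of points of
      \<open>C\<close>: functionals in \<open>P\<close> become positive, the others in
      \<open>T\<close> vanish at \<open>v\<close> and keep their value.\<close>
    define h where "h s = (\<lambda>f. if f \<in> P then 1 else s f)" for s :: "('a \<Rightarrow> real) \<Rightarrow> real"
    let ?w = "\<lambda>s. (-1::int) ^ dim (cell_span W T s)"
    have C0_nonneg: "f x \<ge> 0" if "x \<in> C0" "f \<in> P" for x f
      using that unfolding C0_def C_def P_def by simp
    have shift: "f (x + t *\<^sub>R v) = f x + t * f v" if "f \<in> T" for f x t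
      using linT[OF that] by (simp add: linear_add linear_cmul)
    have CC: "x + v \<in> C - C0" "sgn_vec T (x + v) = h (sgn_vec T x)" if "x \<in> C" for x
    proof -
      have 1: "f (x + v) = f x + f v" if "f \<in> T" for f using shift[OF that, of x 1] by simp
      have 2: "f (x + v) > 0" if "f \<in> P" for f
        using 1[of f] Pv[OF that] \<open>x \<in> C\<close> that PT by (auto simp: C_def P_def T_def add_nonneg_pos)
      show "x + v \<in> C - C0"
      proof -
        have "f (x + v) \<ge> 0" if "f \<in> F" for f
          using 1[of f] v(2)[OF that] \<open>x \<in> C\<close> that by (simp add: C_def T_def)
        moreover have "x + v \<in> W" using \<open>x \<in> C\<close> v W(1) by (simp add: C_def subspace_add)
        ultimately show ?thesis using 2 by (force simp: C_def C0_def)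
      qed
      show "sgn_vec T (x + v) = h (sgn_vec T x)"
      proof
        fix f
        show "sgn_vec T (x + v) f = h (sgn_vec T x) f"
          using 1[of f] 2[of f] Tv[of f] PT by (auto simp: sgn_vec_def h_def)
      qed
    qed
    have surj: "\<exists>y\<in>C0. sgn_vec T x = h (sgn_vec T y)" if x: "x \<in> C - C0" for x
    proof -
      \<comment> \<open>\<open>m\<close> is the largest multiple of \<open>v\<close> that can be
        subtracted from \<open>x\<close> before a functional in \<open>P\<close> turns negative; the
        minimising \<open>f0\<close> vanishes at \<open>y\<close>, which puts \<open>y\<close> into
        \<open>C0\<close>.\<close>
      define m where "m = Min ((\<lambda>f. f x / f v) ` P)"
      have ne: "P \<noteq> {}" using f1 by (auto simp: P_def)
      have "m \<in> (\<lambda>f. f x / f v) ` P" unfolding m_def using finP ne by (intro Min_in) auto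
      then obtain f0 where f0: "f0 \<in> P" "m = f0 x / f0 v" by blast
      have ml: "m \<le> f x / f v" if "f \<in> P" for f unfolding m_def using finP that by simp
      have pos: "f x > 0" if "f \<in> P" for f
        using x that by (auto simp: C_def C0_def P_def order_less_le)
      define y where "y = x + (- m) *\<^sub>R v"
      have y: "f y = f x - m * f v" if "f \<in> T" for f
        using shift[OF that, of x "-m"] by (simp add: y_def)
      have yP: "f y \<ge> 0" if "f \<in> P" for f
        using y[of f] ml[OF that] Pv[OF that] PT that by (auto simp: field_simps)
      have yF: "f y = f x" if "f \<in> T" "f \<notin> P" for f using y[OF that(1)] Tv[OF that] by simp
      have "f y \<ge> 0" if "f \<in> F" for f
        using yP[of f] yF[of f] that x by (cases "f \<in> P") (auto simp: C_def T_def)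
      moreover have "f0 y = 0" using y[of f0] f0 Pv[of f0] PT by auto
      moreover have "y \<in> W" unfolding y_def using x v W(1)
        by (auto simp: C_def intro!: subspace_add subspace_scale subspace_diff)
      ultimately have "y \<in> C0" using f0 by (auto simp: C0_def C_def)
      moreover have "sgn_vec T x = h (sgn_vec T y)"
      proof
        fix f
        show "sgn_vec T x f = h (sgn_vec T y) f"
          using pos[of f] yF[of f] PT by (auto simp: sgn_vec_def h_def)
      qed
      ultimately show ?thesis by blast
    qed
    \<comment> \<open>On \<open>C0\<close> the least ratio \<open>f x / f v\<close> over
      \<open>P\<close> is 0, so \<open>f\<close> vanishes exactly when no ratio is smaller than its
      own. The signs of \<open>d f g\<close> express this and are untouched by \<open>h\<close>,
      whence \<open>h\<close> is injective.\<close>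
    have char0: "f x = 0 \<longleftrightarrow> (\<forall>g\<in>P. sgn_vec T x (d f g) \<noteq> 1)" if "x \<in> C0" "f \<in> P" for x f
    proof -
      obtain f0 where f0: "f0 \<in> P" "f0 x = 0" using \<open>x \<in> C0\<close> by (auto simp: C0_def)
      have nn: "g x \<ge> 0" if "g \<in> P" for g using that(1) \<open>x \<in> C0\<close> by (rule C0_nonneg[rotated])
      have s1: "sgn_vec T x (d f g) = 1 \<longleftrightarrow> f x * g v > g x * f v" if "g \<in> P" for g
        using dT[OF \<open>f \<in> P\<close> that] by (auto simp: sgn_vec_def d_def sgn_real_def split: if_splits)
      show ?thesis
      proof
        assume "f x = 0"
        show "\<forall>g\<in>P. sgn_vec T x (d f g) \<noteq> 1"
        proof
          fix g assume "g \<in> P"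
          from s1[OF this] nn[OF this] \<open>f x = 0\<close> Pv[OF that(2)]
          show "sgn_vec T x (d f g) \<noteq> 1" by (simp add: not_less)
        qed
      next
        assume "\<forall>g\<in>P. sgn_vec T x (d f g) \<noteq> 1"
        with f0(1) have "sgn_vec T x (d f f0) \<noteq> 1" by blast
        then have "f x * f0 v \<le> 0" using s1[OF f0(1)] f0(2) by simp
        then show "f x = 0" using nn[OF that(2)] Pv[OF f0(1)]
          by (simp add: mult_le_0_iff)
      qed
    qed
    have "inj_on h (sgn_vec T ` C0)"
    proof (intro inj_onI, clarify)
      fix x y assume xy: "x \<in> C0" "y \<in> C0" and eq: "h (sgn_vec T x) = h (sgn_vec T y)"
      have off: "sgn_vec T x f = sgn_vec T y f" if "f \<notin> P" for f
        using fun_cong[OF eq, of f] that by (simp add: h_def)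
      have "sgn_vec T x f = sgn_vec T y f" for f
      proof (cases "f \<in> P")
        case True
        then have "f x \<ge> 0" "f y \<ge> 0" using xy C0_nonneg by blast+
        moreover have "f x = 0 \<longleftrightarrow> f y = 0"
          using char0[OF xy(1) True] char0[OF xy(2) True] off dnP by simp
        ultimately show ?thesis by (auto simp: sgn_vec_def sgn_real_def)
      qed (rule off)
      then show "sgn_vec T x = sgn_vec T y" by blast
    qed
    moreover have "h ` sgn_vec T ` C0 = sgn_vec T ` (C - C0)"
    proof -
      have "h (sgn_vec T x) \<in> sgn_vec T ` (C - C0)" if "x \<in> C0" for x
        using CC[of x] that by (force simp: C0_def)
      moreover have "sgn_vec T x \<in> h ` sgn_vec T ` C0" if "x \<in> C - C0" for x
        using surj[OF that] by blast
      ultimately show ?thesis by blast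
    qed
    ultimately have bij: "bij_betw h (sgn_vec T ` C0) (sgn_vec T ` (C - C0))"
      by (simp add: bij_betw_def)
    have w: "?w (h s) = - ?w s" if "s \<in> sgn_vec T ` C0" for s
    proof -
      from that obtain x where x: "x \<in> C0" "s = sgn_vec T x" by blast
      obtain f0 where f0: "f0 \<in> P" "f0 x = 0" using x by (auto simp: C0_def)
      let ?S = "cell_span W T (h s)"
      have h0: "h s f = 0 \<longleftrightarrow> f \<notin> P \<and> f x = 0" if "f \<in> T" for f
        using that x by (auto simp: h_def sgn_vec_def sgn_0_0)
      have s0: "s f = 0 \<longleftrightarrow> f x = 0" if "f \<in> T" for f
        using that x by (auto simp: sgn_vec_def sgn_0_0)
      \<comment> \<open>For \<open>f\<close> in \<open>P\<close> with \<open>f x = 0\<close> the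
        functional \<open>d f f0\<close> vanishes at \<open>x\<close>, hence on \<open>?S\<close>,
        where \<open>f\<close> is therefore a multiple of \<open>f0\<close>. So the single equation
        \<open>f0 y = 0\<close> recovers all equations dropped by \<open>h\<close>.\<close>
      have "{y \<in> ?S. f0 y = 0} = cell_span W T s"
      proof (intro set_eqI iffI)
        fix y assume y: "y \<in> {y \<in> ?S. f0 y = 0}"
        have "f y = 0" if "f \<in> T" "f x = 0" for f
        proof (cases "f \<in> P")
          case True
          have "d f f0 x = 0" using f0 that by (simp add: d_def)
          then have "d f f0 y = 0"
            using y h0[OF dT[OF True f0(1)]] dnP dT[OF True f0(1)] by (auto simp: cell_span_def)
          then show ?thesis using y Pv[OF f0(1)] by (simp add: d_def)
        qed (use y h0 that in \<open>auto simp: cell_span_def\<close>)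
        then show "y \<in> cell_span W T s" using y s0 by (auto simp: cell_span_def)
      next
        fix y assume "y \<in> cell_span W T s"
        then show "y \<in> {y \<in> ?S. f0 y = 0}"
          using h0 s0 f0 PT by (auto simp: cell_span_def)
      qed
      moreover have "dim ?S = Suc (dim {y \<in> ?S. f0 y = 0})"
      proof (rule dim_kernel_functional)
        show "subspace ?S" by (rule subspace_cell_span[OF W(1) linT])
        show "?S \<subseteq> span B" using W(3) by (auto simp: cell_span_def)
        \<comment> \<open>Only functionals outside \<open>P\<close> impose equations on
          \<open>?S\<close>, and they vanish at \<open>v\<close>. Since \<open>f0 v > 0\<close>, the
          dimension drops by exactly one.\<close>
        show "v \<in> ?S" using v(1) h0 Tv by (auto simp: cell_span_def)
        show "f0 v \<noteq> 0" using Pv f0 by force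
        show "linear f0" using linT PT f0 by blast
      qed (rule W(2))
      ultimately show ?thesis by simp
    qed
    have disj: "sgn_vec T ` C0 \<inter> sgn_vec T ` (C - C0) = {}"
    proof -
      have False if "x \<in> C0" "y \<in> C - C0" "sgn_vec T x = sgn_vec T y" for x y
      proof -
        obtain f where f: "f \<in> P" "f x = 0" using \<open>x \<in> C0\<close> by (auto simp: C0_def)
        then have "sgn (f y) = sgn (f x)" using that(3) PT unfolding sgn_vec_eq_iff by (metis subsetD)
        then have "f y = 0" using f by (simp add: sgn_0_0)
        then show False using that(2) f(1) unfolding C0_def by blast
      qed
      then show ?thesis by blast
    qed
    have "C = C0 \<union> (C - C0)" by (auto simp: C0_def)
    then have "cell_sum W T C = (\<Sum>s\<in>sgn_vec T ` C0 \<union> sgn_vec T ` (C - C0). ?w s)"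
      unfolding cell_sum_def by (metis image_Un)
    also have "\<dots> = (\<Sum>s\<in>sgn_vec T ` C0. ?w s) + (\<Sum>s\<in>sgn_vec T ` (C - C0). ?w s)"
      by (rule sum.union_disjoint) (use disj finT in \<open>auto simp: finite_sgn_vec_image\<close>)
    also have "(\<Sum>s\<in>sgn_vec T ` (C - C0). ?w s) = (\<Sum>s\<in>sgn_vec T ` C0. ?w (h s))"
      by (rule sum.reindex_bij_betw[OF bij, symmetric])
    also have "\<dots> = (\<Sum>s\<in>sgn_vec T ` C0. - ?w s)"
      by (rule sum.cong) (use w in auto)
    finally show ?thesis by (simp add: sum_negf)
  qed
  finally show ?thesis by (simp add: C_def)
qed

section \<open>Hall's theorem\<close>

text \<open>The Halmos-Vaughan induction. A proper nonempty tight set \<open>A\<close> is matched on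
  its own and the rest into values that \<open>A\<close> does not see; Hall's condition for the rest
  comes from \<open>A\<close> joined with \<open>D\<close>. Without a tight set any pair
  \<open>a\<close>, \<open>b\<close> may be fixed, because a surplus of one survives the loss of
  \<open>b\<close>.\<close>

lemma hall:
  fixes N :: "'a \<Rightarrow> 'b set"
  assumes "finite L" "\<And>a. a \<in> L \<Longrightarrow> finite (N a)"
    and "\<And>A. A \<subseteq> L \<Longrightarrow> card A \<le> card (\<Union>(N ` A))"
  shows "\<exists>m. inj_on m L \<and> (\<forall>a\<in>L. m a \<in> N a)"
  using assms
proof (induction "card L" arbitrary: L N rule: less_induct)
  case less
  note fin = less.prems(1,2) and hall = less.prems(3)
  show ?case
  proof (cases "L = {}")
    case False
    show ?thesis
    proof (cases "\<exists>A\<subseteq>L. A \<noteq> {} \<and> A \<noteq> L \<and> card (\<Union>(N ` A)) = card A")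
      case True
      then obtain A where A: "A \<subseteq> L" "A \<noteq> {}" "A \<noteq> L" "card (\<Union>(N ` A)) = card A" by blast
      have finA: "finite A" using A fin finite_subset by blast
      have "card A < card L" using A fin by (simp add: psubset_card_mono psubsetI)
      then have "\<exists>m. inj_on m A \<and> (\<forall>a\<in>A. m a \<in> N a)"
        by (rule less.hyps) (use A fin hall finA in \<open>auto 0 3\<close>)
      then obtain m1 where m1: "inj_on m1 A" "\<forall>a\<in>A. m1 a \<in> N a" by blast
      define N' where "N' a = N a - \<Union>(N ` A)" for a
      have "card (L - A) < card L" using A fin finA
        by (metis card_Diff_subset card_gt_0_iff diff_less finite_subset subset_empty)
      then have "\<exists>m. inj_on m (L - A) \<and> (\<forall>a\<in>L - A. m a \<in> N' a)"
      proof (rule less.hyps)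
        fix D assume D: "D \<subseteq> L - A"
        have finD: "finite D" using D fin finite_subset by blast
        have finN: "finite (\<Union>(N ` X))" if "X \<subseteq> L" for X
          using that fin by (meson finite_UN finite_subset subset_iff)
        have "card A + card D = card (A \<union> D)"
          using D finA finD by (subst card_Un_disjoint) auto
        also have "\<dots> \<le> card (\<Union>(N ` (A \<union> D)))" by (rule hall) (use A D in auto)
        also have "\<Union>(N ` (A \<union> D)) = \<Union>(N ` A) \<union> \<Union>(N' ` D)" by (auto simp: N'_def)
        also have "card \<dots> = card (\<Union>(N ` A)) + card (\<Union>(N' ` D))"
          using finN[of A] finN[of D] A D
          by (intro card_Un_disjoint) (auto simp: N'_def intro: finite_subset)
        finally show "card D \<le> card (\<Union>(N' ` D))" using A by simp
      qed (use fin in \<open>auto simp: N'_def\<close>)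
      then obtain m2 where m2: "inj_on m2 (L - A)" "\<forall>a\<in>L - A. m2 a \<in> N' a" by blast
      let ?m = "\<lambda>a. if a \<in> A then m1 a else m2 a"
      have "inj_on ?m L"
      proof (rule inj_onI)
        fix a b assume "a \<in> L" "b \<in> L" "?m a = ?m b"
        moreover have "m1 c \<noteq> m2 d" if "c \<in> A" "d \<in> L - A" for c d
          using m1(2) m2(2) that by (auto simp: N'_def)
        ultimately show "a = b"
          using m1(1) m2(1) by (metis DiffI inj_onD)
      qed
      moreover have "\<forall>a\<in>L. ?m a \<in> N a" using m1 m2 by (auto simp: N'_def)
      ultimately show ?thesis by blast
    next
      case no: False
      obtain a where a: "a \<in> L" using \<open>L \<noteq> {}\<close> by blast
      have "card {a} \<le> card (\<Union>(N ` {a}))" by (rule hall) (use a in auto)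
      then have "N a \<noteq> {}" by auto
      then obtain b where b: "b \<in> N a" by blast
      define N' where "N' c = N c - {b}" for c
      have "card (L - {a}) < card L" using a fin by (meson card_Diff1_less)
      then have "\<exists>m. inj_on m (L - {a}) \<and> (\<forall>c\<in>L - {a}. m c \<in> N' c)"
      proof (rule less.hyps)
        fix D assume D: "D \<subseteq> L - {a}"
        show "card D \<le> card (\<Union>(N' ` D))"
        proof (cases "D = {}")
          case False
          have "card D \<le> card (\<Union>(N ` D))" by (rule hall) (use D in auto)
          moreover have "card (\<Union>(N ` D)) \<noteq> card D" using no D False a by blast
          ultimately have "card D < card (\<Union>(N ` D))" by simp
          moreover have "\<Union>(N' ` D) = \<Union>(N ` D) - {b}" by (auto simp: N'_def)
          moreover have "card (\<Union>(N ` D)) - 1 \<le> card (\<Union>(N ` D) - {b})"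
            by (metis card_Diff_singleton_if diff_le_self order_refl)
          ultimately show ?thesis by simp
        qed simp
      qed (use fin in \<open>auto simp: N'_def\<close>)
      then obtain m where m: "inj_on m (L - {a})" "\<forall>c\<in>L - {a}. m c \<in> N' c" by blast
      have "inj_on (m(a := b)) L"
        using m by (auto simp: inj_on_def N'_def)
      moreover have "\<forall>c\<in>L. (m(a := b)) c \<in> N c" using m b by (auto simp: N'_def)
      ultimately show ?thesis by blast
    qed
  qed auto
qed

section \<open>Balanced edge weightings\<close>

lemma perfect_matchingI:
  assumes "bij_betw m {1..n} {1..n}"
  shows "perfect_matching n ((\<lambda>i. (i, m i)) ` {1..n})"
  unfolding perfect_matching_def
proof (intro conjI ballI)
  show "(\<lambda>i. (i, m i)) ` {1..n} \<subseteq> Knn n"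
    using assms by (auto simp: Knn_def bij_betw_def)
  fix v assume "v \<in> verts n"
  then consider i where "i \<in> {1..n}" "v = Inl i" | j where "j \<in> {1..n}" "v = Inr j"
    by (auto simp: verts_def)
  then show "\<exists>!e. e \<in> (\<lambda>i. (i, m i)) ` {1..n} \<and> v \<in> ends e"
  proof cases
    case 1
    then show ?thesis by (intro ex1I[of _ "(i, m i)"]) (auto simp: ends_def)
  next
    case 2
    then obtain i where i: "i \<in> {1..n}" "m i = j"
      using assms by (metis bij_betw_apply bij_betw_inv_into_right bij_betw_inv_into)
    have uniq: "k = i" if "k \<in> {1..n}" "m k = j" for k
      using assms that i unfolding bij_betw_def inj_on_def by metis
    show ?thesis unfolding 2(2)
    proof (rule ex1I[of _ "(i, j)"])
      show "(i, j) \<in> (\<lambda>i. (i, m i)) ` {1..n} \<and> Inr j \<in> ends (i, j)"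
        using i by (auto simp: ends_def image_iff)
      fix e assume "e \<in> (\<lambda>i. (i, m i)) ` {1..n} \<and> Inr j \<in> ends e"
      then obtain k where k: "k \<in> {1..n}" "e = (k, m k)" "m k = j" by (auto simp: ends_def)
      with uniq[OF k(1,3)] show "e = (i, j)" by simp
    qed
  qed
qed

definition vsum :: "nat \<Rightarrow> (edge \<Rightarrow> real) \<Rightarrow> vertex \<Rightarrow> real" where
  "vsum n x u = (case u of Inl i \<Rightarrow> \<Sum>j=1..n. x (i, j) | Inr j \<Rightarrow> \<Sum>i=1..n. x (i, j))"

lemma vsum_simps [simp]:
  "vsum n x (Inl i) = (\<Sum>j=1..n. x (i, j))"
  "vsum n x (Inr j) = (\<Sum>i=1..n. x (i, j))"
  by (simp_all add: vsum_def)

text \<open>The common degree, read off at \<open>Inl 1\<close>, is left free, which makes this a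
  linear subspace.\<close>

definition balanced :: "nat \<Rightarrow> edge set \<Rightarrow> (edge \<Rightarrow> real) set" where
  "balanced n G = {x. (\<forall>e. e \<notin> G \<longrightarrow> x e = 0) \<and> (\<forall>u\<in>verts n. vsum n x u = vsum n x (Inl 1))}"

text \<open>With all edges oriented from left to right, degree zero means that \<open>x\<close> is a
  circulation, so this is the usual real cycle space of \<open>G\<close>.\<close>

definition cycle_space :: "nat \<Rightarrow> edge set \<Rightarrow> (edge \<Rightarrow> real) set" where
  "cycle_space n G = {x. (\<forall>e. e \<notin> G \<longrightarrow> x e = 0) \<and> (\<forall>u\<in>verts n. vsum n x u = 0)}"

lemma vsum_indicator_perfect_matching:
  assumes "perfect_matching n M" "u \<in> verts n"
  shows "vsum n (indicator M) u = 1"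
proof -
  obtain e where e: "e \<in> M" "u \<in> ends e" "\<And>e'. e' \<in> M \<Longrightarrow> u \<in> ends e' \<Longrightarrow> e' = e"
    using assms unfolding perfect_matching_def by metis
  have eK: "e \<in> Knn n" using e(1) assms(1) unfolding perfect_matching_def by blast
  show ?thesis
  proof (cases u)
    case (Inl i)
    have "vsum n (indicator M) u = (\<Sum>j=1..n. if j = snd e then 1 else 0)"
      unfolding Inl vsum_simps
    proof (rule sum.cong[OF refl])
      fix j
      have "(i, j) \<in> M \<longleftrightarrow> j = snd e"
      proof
        assume "(i, j) \<in> M"
        then have "(i, j) = e" by (rule e(3)) (simp add: Inl ends_def)
        then show "j = snd e" by auto
      next
        assume "j = snd e"
        then have "(i, j) = e" using e(2) Inl by (simp add: ends_def)
        then show "(i, j) \<in> M" using e(1) by simp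
      qed
      then show "indicator M (i, j) = (if j = snd e then 1 else 0 :: real)" by (simp add: indicator_def)
    qed
    also have "\<dots> = 1" using eK by (auto simp: Knn_def)
    finally show ?thesis .
  next
    case (Inr j)
    have "vsum n (indicator M) u = (\<Sum>i=1..n. if i = fst e then 1 else 0)"
      unfolding Inr vsum_simps
    proof (rule sum.cong[OF refl])
      fix i
      have "(i, j) \<in> M \<longleftrightarrow> i = fst e"
      proof
        assume "(i, j) \<in> M"
        then have "(i, j) = e" by (rule e(3)) (simp add: Inr ends_def)
        then show "i = fst e" by auto
      next
        assume "i = fst e"
        then have "(i, j) = e" using e(2) Inr by (simp add: ends_def)
        then show "(i, j) \<in> M" using e(1) by simp
      qed
      then show "indicator M (i, j) = (if i = fst e then 1 else 0 :: real)" by (simp add: indicator_def)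
    qed
    also have "\<dots> = 1" using eK by (auto simp: Knn_def)
    finally show ?thesis .
  qed
qed

text \<open>Hall's condition is checked for the support with row \<open>p\<close> and column
  \<open>q\<close> removed. Rows \<open>A\<close> carry total weight \<open>t * card A\<close>, all
  of it in column \<open>q\<close> and the columns \<open>R\<close>. The columns \<open>R\<close>
  hold at most \<open>t * card R\<close>, and column \<open>q\<close> contributes less than
  \<open>t\<close> because \<open>x (p, q)\<close> lies outside \<open>A\<close>. This strictness
  makes up for the lost column.\<close>

lemma support_edge_in_perfect_matching:
  assumes x: "x \<in> balanced n (Knn n)" "\<And>e. x e \<ge> 0" and pq: "x (p, q) > 0"
  shows "\<exists>M. perfect_matching n M \<and> (p, q) \<in> M \<and> M \<subseteq> {e. x e > 0}"
proof -
  define t where "t = vsum n x (Inl 1)"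
  have row: "(\<Sum>j=1..n. x (i, j)) = t" if "i \<in> {1..n}" for i
    using x(1) that unfolding balanced_def t_def verts_def by (auto dest!: bspec[of _ _ "Inl i"])
  have col: "(\<Sum>i=1..n. x (i, j)) = t" if "j \<in> {1..n}" for j
    using x(1) that unfolding balanced_def t_def verts_def by (auto dest!: bspec[of _ _ "Inr j"])
  have "(p, q) \<in> Knn n" using x(1) pq unfolding balanced_def by (metis (mono_tags, lifting) less_irrefl mem_Collect_eq)
  then have p: "p \<in> {1..n}" and q: "q \<in> {1..n}" by (auto simp: Knn_def)
  have "x (p, q) \<le> (\<Sum>j=1..n. x (p, j))" by (rule member_le_sum) (use q x in auto)
  then have t: "t > 0" using row[OF p] pq by simp
  define N where "N i = {j \<in> {1..n}. x (i, j) > 0} - {q}" for i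
  have "\<exists>m. inj_on m ({1..n} - {p}) \<and> (\<forall>i\<in>{1..n} - {p}. m i \<in> N i)"
  proof (rule hall[of "{1..n} - {p}" N])
    fix A assume A: "A \<subseteq> {1..n} - {p}"
    have finA: "finite A" using A finite_subset by blast
    define R where "R = \<Union>(N ` A)"
    have R: "R \<subseteq> {1..n} - {q}" by (auto simp: R_def N_def)
    have finR: "finite R" using R finite_subset by blast
    have "t * card A = (\<Sum>i\<in>A. \<Sum>j=1..n. x (i, j))"
      using A row by (simp add: subset_eq)
    also have "\<dots> = (\<Sum>i\<in>A. \<Sum>j\<in>insert q R. x (i, j))"
    proof (rule sum.cong[OF refl], rule sum.mono_neutral_right, goal_cases)
      case (3 i)
      show ?case
      proof
        fix j assume "j \<in> {1..n} - insert q R"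
        with 3 have "\<not> x (i, j) > 0" by (auto simp: R_def N_def)
        then show "x (i, j) = 0" using x(2)[of "(i, j)"] by linarith
      qed
    qed (use q R in auto)
    also have "\<dots> = (\<Sum>j\<in>insert q R. \<Sum>i\<in>A. x (i, j))" by (rule sum.swap)
    also have "\<dots> = (\<Sum>i\<in>A. x (i, q)) + (\<Sum>j\<in>R. \<Sum>i\<in>A. x (i, j))"
      using R finR by (subst sum.insert) auto
    also have "(\<Sum>j\<in>R. \<Sum>i\<in>A. x (i, j)) \<le> (\<Sum>j\<in>R. t)"
    proof (rule sum_mono)
      fix j assume "j \<in> R"
      have "(\<Sum>i\<in>A. x (i, j)) \<le> (\<Sum>i=1..n. x (i, j))"
        by (rule sum_mono2) (use A x in auto)
      then show "(\<Sum>i\<in>A. x (i, j)) \<le> t" using col[of j] R \<open>j \<in> R\<close> by auto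
    qed
    also have "(\<Sum>i\<in>A. x (i, q)) < t"
    proof -
      have "(\<Sum>i\<in>A. x (i, q)) < (\<Sum>i\<in>insert p A. x (i, q))"
        using A finA pq by (subst sum.insert) auto
      also have "\<dots> \<le> (\<Sum>i=1..n. x (i, q))" by (rule sum_mono2) (use A x p in auto)
      finally show ?thesis using col[OF q] by simp
    qed
    finally have "t * card A < t * (1 + card R)" by (simp add: algebra_simps)
    then have "real (card A) < 1 + real (card R)" using t by (simp only: mult_less_cancel_left_pos)
    then show "card A \<le> card (\<Union>(N ` A))" unfolding R_def[symmetric] by linarith
  qed (auto simp: N_def)
  then obtain m where m: "inj_on m ({1..n} - {p})" "\<forall>i\<in>{1..n} - {p}. m i \<in> N i" by blast
  define m' where "m' = m(p := q)"
  have "q \<notin> m ` ({1..n} - {p})" using m(2) by (auto simp: N_def)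
  moreover have "inj_on m' ({1..n} - {p}) \<longleftrightarrow> inj_on m ({1..n} - {p})"
    by (rule inj_on_cong) (simp add: m'_def)
  moreover have "m' ` ({1..n} - {p}) = m ` ({1..n} - {p})"
    by (rule image_cong) (simp_all add: m'_def)
  moreover have "m' p = q" by (simp add: m'_def)
  ultimately have "inj_on m' (insert p ({1..n} - {p}))"
    unfolding inj_on_insert using m(1) by simp
  then have inj: "inj_on m' {1..n}" using p by (simp add: insert_absorb)
  have "m' ` {1..n} \<subseteq> {1..n}" using m q by (auto simp: m'_def N_def)
  then have "bij_betw m' {1..n} {1..n}"
    using inj by (simp add: bij_betw_def endo_inj_surj)
  from perfect_matchingI[OF this] show ?thesis
    using m pq p by (intro exI[of _ "(\<lambda>i. (i, m' i)) ` {1..n}"]) (auto simp: m'_def N_def image_iff)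
qed

text \<open>Every edge of a support lies in a perfect matching inside that support; conversely, the
  sum of the indicators of the covering matchings is balanced and has support \<open>H\<close>. The
  empty set is the support of the apex.\<close>

lemma matching_covered_iff_support:
  assumes n: "n \<ge> 1" and G: "G \<subseteq> Knn n"
  shows "(\<exists>x\<in>balanced n G. (\<forall>e. x e \<ge> 0) \<and> {e. x e > 0} = H) \<longleftrightarrow>
    H = {} \<or> (H \<subseteq> G \<and> matching_covered n H)" (is "?l \<longleftrightarrow> ?r")
proof
  assume ?l
  then obtain x where x: "x \<in> balanced n G" "\<And>e. x e \<ge> 0" and H: "H = {e. x e > 0}" by blast
  have xK: "x \<in> balanced n (Knn n)" using x(1) G unfolding balanced_def by blast
  have "H \<subseteq> G" using x(1) by (auto simp: H balanced_def order_less_le)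
  moreover have "matching_covered n H" if "H \<noteq> {}"
  proof -
    have ex: "\<exists>M. perfect_matching n M \<and> e \<in> M \<and> M \<subseteq> H" if "e \<in> H" for e
      using support_edge_in_perfect_matching[OF xK x(2), of "fst e" "snd e"] that by (simp add: H)
    show ?thesis unfolding matching_covered_def
      by (rule exI[of _ "{M. perfect_matching n M \<and> M \<subseteq> H}"]) (use ex that in blast)
  qed
  ultimately show ?r by blast
next
  assume ?r
  then show ?l
  proof
    assume "H = {}"
    then show ?l
      by (intro bexI[of _ "\<lambda>_. 0"]) (auto simp: balanced_def verts_def)
  next
    assume "H \<subseteq> G \<and> matching_covered n H"
    then obtain \<M> where M: "\<And>M. M \<in> \<M> \<Longrightarrow> perfect_matching n M" "H = \<Union>\<M>" and HG: "H \<subseteq> G"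
      unfolding matching_covered_def by blast
    have "\<M> \<subseteq> Pow (Knn n)" using M(1) by (auto simp: perfect_matching_def)
    then have fin: "finite \<M>" by (rule finite_subset) (simp add: Knn_def)
    define x where "x e = (\<Sum>M\<in>\<M>. indicator M e :: real)" for e :: edge
    have vs: "vsum n x u = card \<M>" if "u \<in> verts n" for u
    proof -
      have "vsum n x u = (\<Sum>M\<in>\<M>. vsum n (indicator M) u)"
        unfolding x_def vsum_def by (cases u) (auto intro: sum.swap)
      also have "\<dots> = (\<Sum>M\<in>\<M>. 1)"
        by (rule sum.cong) (use vsum_indicator_perfect_matching M(1) that in auto)
      finally show ?thesis by simp
    qed
    have nn: "x e \<ge> 0" for e by (simp add: x_def sum_nonneg)
    have pos: "x e > 0 \<longleftrightarrow> e \<in> H" for e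
    proof -
      have "x e \<noteq> 0 \<longleftrightarrow> (\<exists>M\<in>\<M>. (indicator M e :: real) \<noteq> 0)"
        unfolding x_def using fin by (subst sum_nonneg_eq_0_iff) (auto simp: indicator_def)
      then show ?thesis using M(2) nn[of e] by (auto simp: indicator_def order_less_le)
    qed
    have "x e = 0" if "e \<notin> G" for e using pos[of e] nn[of e] HG that by (auto simp: order_less_le)
    moreover have "Inl 1 \<in> verts n" using n by (auto simp: verts_def)
    ultimately have "x \<in> balanced n G" unfolding balanced_def using vs by (simp del: vsum_simps)
    then show ?l using nn pos by (intro bexI[of _ x]) auto
  qed
qed

section \<open>The cycle space\<close>

text \<open>Edge weightings become a real vector space, so that \<open>span\<close> and
  \<open>dim\<close> apply to them.\<close>

instantiation "fun" :: (type, real_vector) real_vector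
begin

definition scaleR_fun :: "real \<Rightarrow> ('a \<Rightarrow> 'b) \<Rightarrow> 'a \<Rightarrow> 'b" where
  "scaleR_fun r f = (\<lambda>x. r *\<^sub>R f x)"

instance
  by standard (auto simp: scaleR_fun_def fun_eq_iff scaleR_add_right scaleR_add_left)

end

lemma scaleR_fun_apply [simp]: "(r *\<^sub>R f) x = r *\<^sub>R f x"
  by (simp add: scaleR_fun_def)

lemma sum_apply: "(\<Sum>i\<in>I. f i) x = (\<Sum>i\<in>I. f i x)" for f :: "'i \<Rightarrow> 'a \<Rightarrow> 'b::comm_monoid_add"
  by (induction I rule: infinite_finite_induct) auto

lemma dim_zero: "dim {0 :: 'a::real_vector} = 0"
  by (metis span_empty dim_span dim_eq_card_independent independent_empty card.empty)

lemma finite_Knn [simp]: "finite (Knn n)"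
  by (simp add: Knn_def)

lemma finite_verts [simp]: "finite (verts n)"
  by (simp add: verts_def)

lemma vsum_linear [simp]:
  "vsum n (x + y) u = vsum n x u + vsum n y u"
  "vsum n (x - y) u = vsum n x u - vsum n y u"
  "vsum n (r *\<^sub>R x) u = r * vsum n x u"
  "vsum n 0 u = 0"
  by (cases u; simp add: sum.distrib sum_subtractf sum_distrib_left)+

lemma linear_vsum: "linear (\<lambda>x. vsum n x u)"
  by (intro linearI) auto

lemma linear_apply: "linear (\<lambda>x. x e :: real)"
  by (intro linearI) auto

lemma vsum_indicator_edge:
  "e \<in> Knn n \<Longrightarrow> vsum n (indicator {e}) u = of_bool (u \<in> ends e)"
  by (cases u; cases e)
    (auto simp: Knn_def ends_def indicator_def of_bool_def if_distrib cong: if_cong)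

lemma subspace_balanced: "subspace (balanced n G)"
  by (auto simp: subspace_def balanced_def simp del: vsum_simps)

lemma subspace_cycle_space: "subspace (cycle_space n G)"
  by (auto simp: subspace_def cycle_space_def simp del: vsum_simps)

lemma supported_in_span:
  assumes "finite G" "\<And>e. e \<notin> G \<Longrightarrow> x e = (0::real)"
  shows "x \<in> span ((\<lambda>e. indicator {e}) ` G)"
proof -
  have "x = (\<Sum>e\<in>G. x e *\<^sub>R indicator {e})"
  proof
    fix a
    have "(\<Sum>e\<in>G. x e *\<^sub>R indicator {e}) a = (\<Sum>e\<in>G. if e = a then x e else 0)"
      unfolding sum_apply by (rule sum.cong) (auto simp: indicator_def)
    also have "\<dots> = x a" using assms by auto
    finally show "x a = (\<Sum>e\<in>G. x e *\<^sub>R indicator {e}) a" by simp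
  qed
  also have "\<dots> \<in> span ((\<lambda>e. indicator {e}) ` G)"
    by (intro span_sum span_scale span_base) auto
  finally show ?thesis .
qed

section \<open>Connected components when an edge is added\<close>

lemma adjacency_insert:
  "adjacency (insert (i, j) G) = insert (Inl i, Inr j) (insert (Inr j, Inl i) (adjacency G))"
  by (auto simp: adjacency_def ends_def doubleton_eq_iff)

lemma sym_reachable: "(u, v) \<in> (adjacency G)\<^sup>* \<Longrightarrow> (v, u) \<in> (adjacency G)\<^sup>*"
proof -
  have "sym (adjacency G)" by (auto simp: sym_def adjacency_def insert_commute)
  then show "(u, v) \<in> (adjacency G)\<^sup>* \<Longrightarrow> (v, u) \<in> (adjacency G)\<^sup>*"
    using sym_rtrancl symD by metis
qed

definition component_of :: "nat \<Rightarrow> edge set \<Rightarrow> vertex \<Rightarrow> vertex set" where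
  "component_of n G u = {v \<in> verts n. (u, v) \<in> (adjacency G)\<^sup>*}"

lemma components_eq: "components n G = component_of n G ` verts n"
  by (auto simp: components_def quotient_def component_of_def)

lemma component_of_eq_iff:
  assumes "u \<in> verts n" "v \<in> verts n"
  shows "component_of n G u = component_of n G v \<longleftrightarrow> (u, v) \<in> (adjacency G)\<^sup>*"
proof
  assume "component_of n G u = component_of n G v"
  then have "v \<in> component_of n G u" using assms by (auto simp: component_of_def)
  then show "(u, v) \<in> (adjacency G)\<^sup>*" by (simp add: component_of_def)
next
  assume uv: "(u, v) \<in> (adjacency G)\<^sup>*"
  show "component_of n G u = component_of n G v"
    unfolding component_of_def using uv sym_reachable[OF uv] by (auto intro: rtrancl_trans)
qed

lemma components_insert_connected:
  assumes "(Inl i, Inr j) \<in> (adjacency G)\<^sup>*"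
  shows "components n (insert (i, j) G) = components n G"
proof -
  have "(adjacency (insert (i, j) G))\<^sup>* = (adjacency G)\<^sup>*"
    unfolding adjacency_insert
  proof (rule rtrancl_subset)
    show "insert (Inl i, Inr j) (insert (Inr j, Inl i) (adjacency G)) \<subseteq> (adjacency G)\<^sup>*"
      using assms sym_reachable by auto
  qed auto
  then show ?thesis by (simp add: components_def)
qed

text \<open>The classes of the two ends merge into a class that was not there before, and all other
  classes stay.\<close>

lemma card_components_insert_disconnected:
  assumes ij: "(i, j) \<in> Knn n" and nc: "(Inl i, Inr j) \<notin> (adjacency G)\<^sup>*"
  shows "card (components n G) = Suc (card (components n (insert (i, j) G)))"
proof -
  let ?a = "Inl i :: vertex" and ?b = "Inr j :: vertex" and ?R = "(adjacency G)\<^sup>*"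
  let ?A = "component_of n G ?a" and ?B = "component_of n G ?b"
  have ab: "?a \<in> verts n" "?b \<in> verts n" using ij by (auto simp: verts_def Knn_def)
  \<comment> \<open>A path can be shortened so that it crosses the new edge at most once, in one of
    the two directions.\<close>
  have R': "(x, y) \<in> (adjacency (insert (i, j) G))\<^sup>* \<longleftrightarrow>
      (x, y) \<in> ?R \<or> (x, ?a) \<in> ?R \<and> (?b, y) \<in> ?R \<or> (x, ?b) \<in> ?R \<and> (?a, y) \<in> ?R" for x y
    unfolding adjacency_insert rtrancl_insert using sym_reachable by (auto intro: rtrancl_trans)
  have shift: "(x, y) \<in> ?R \<longleftrightarrow> (w, y) \<in> ?R" if "(x, w) \<in> ?R" for x y w
    using that sym_reachable by (meson rtrancl_trans)
  have cls: "component_of n (insert (i, j) G) x =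
      (if (x, ?a) \<in> ?R \<or> (x, ?b) \<in> ?R then ?A \<union> ?B else component_of n G x)" for x
  proof (cases "(x, ?a) \<in> ?R")
    case True
    with nc shift[OF True] have "(x, ?b) \<notin> ?R" by blast
    with True show ?thesis unfolding component_of_def R' using shift[OF True] by (simp, blast)
  next
    case a: False
    show ?thesis
    proof (cases "(x, ?b) \<in> ?R")
      case True
      with a show ?thesis unfolding component_of_def R' using shift[OF True] by (simp, blast)
    next
      case False
      with a show ?thesis unfolding component_of_def R' by simp
    qed
  qed
  have "components n (insert (i, j) G) = insert (?A \<union> ?B) (components n G - {?A, ?B})"
  proof (intro set_eqI iffI)
    fix c assume "c \<in> components n (insert (i, j) G)"
    then obtain x where x: "x \<in> verts n" "c = component_of n (insert (i, j) G) x"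
      by (auto simp: components_eq)
    then show "c \<in> insert (?A \<union> ?B) (components n G - {?A, ?B})"
      using component_of_eq_iff[OF x(1) ab(1), of G] component_of_eq_iff[OF x(1) ab(2), of G] cls[of x]
      by (auto simp: components_eq)
  next
    fix c assume c: "c \<in> insert (?A \<union> ?B) (components n G - {?A, ?B})"
    show "c \<in> components n (insert (i, j) G)"
    proof (cases "c = ?A \<union> ?B")
      case True
      then have "c = component_of n (insert (i, j) G) ?a" using cls[of ?a] by simp
      then show ?thesis using ab by (auto simp: components_eq)
    next
      case False
      then obtain x where x: "x \<in> verts n" "c = component_of n G x" "c \<noteq> ?A" "c \<noteq> ?B"
        using c by (auto simp: components_eq)
      then have "c = component_of n (insert (i, j) G) x"
        using component_of_eq_iff[OF x(1) ab(1), of G] component_of_eq_iff[OF x(1) ab(2), of G] cls[of x]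
        by auto
      then show ?thesis using x by (auto simp: components_eq)
    qed
  qed
  moreover have "?A \<union> ?B \<notin> components n G - {?A, ?B}"
  proof
    assume "?A \<union> ?B \<in> components n G - {?A, ?B}"
    then obtain x where x: "x \<in> verts n" "?A \<union> ?B = component_of n G x" "component_of n G x \<noteq> ?A"
      by (auto simp: components_eq)
    have "?a \<in> component_of n G x" using x(2) ab by (auto simp: component_of_def)
    then have "(x, ?a) \<in> ?R" by (simp add: component_of_def)
    then show False using x component_of_eq_iff[OF x(1) ab(1), of G] by simp
  qed
  moreover have fin: "finite (components n G)" by (simp add: components_eq)
  moreover have "{?A, ?B} \<subseteq> components n G" using ab by (auto simp: components_eq)
  moreover have "?A \<noteq> ?B" using component_of_eq_iff[OF ab, of G] nc by simp
  moreover have "card (components n G) = card {?A, ?B} + card (components n G - {?A, ?B})"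
    using calculation by (metis card_Diff_subset card_mono finite.emptyI finite.insertI le_add_diff_inverse)
  ultimately show ?thesis by simp
qed

text \<open>A circulation has no net flow across a cut. Here \<open>c\<close> is the indicator of
  the component of \<open>Inl i\<close>; weighting left degrees by \<open>c\<close> and right
  degrees by \<open>- c\<close> cancels all edges inside \<open>G\<close>, so that
  \<open>z (i, j)\<close> equals a combination of zero degrees.\<close>

lemma cycle_space_disconnected:
  assumes ij: "(i, j) \<in> Knn n" and nc: "(Inl i, Inr j) \<notin> (adjacency G)\<^sup>*"
    and z: "z \<in> cycle_space n (insert (i, j) G)"
  shows "z (i, j) = 0"
proof -
  define c where "c u = (of_bool ((Inl i, u) \<in> (adjacency G)\<^sup>*) :: real)" for u
  have w: "(c (Inl k) - c (Inr l)) * z (k, l) = 0" if "(k, l) \<noteq> (i, j)" for k l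
  proof (cases "(k, l) \<in> G")
    case True
    then have "(Inl k, Inr l) \<in> adjacency G" "(Inr l, Inl k) \<in> adjacency G"
      by (auto simp: adjacency_def ends_def insert_commute intro!: bexI[of _ "(k, l)"])
    then have "(Inl i, Inl k) \<in> (adjacency G)\<^sup>* \<longleftrightarrow> (Inl i, Inr l) \<in> (adjacency G)\<^sup>*"
      by (intro iffI) (erule rtrancl_into_rtrancl, assumption)+
    then have "c (Inl k) = c (Inr l)" by (simp add: c_def)
    then show ?thesis by simp
  next
    case False
    then have "z (k, l) = 0" using z that by (auto simp: cycle_space_def)
    then show ?thesis by simp
  qed
  have rows: "(\<Sum>l=1..n. z (k, l)) = 0" if "k \<in> {1..n}" for k
  proof -
    have "vsum n z (Inl k) = 0" using z that unfolding cycle_space_def verts_def by blast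
    then show ?thesis by simp
  qed
  have cols: "(\<Sum>k=1..n. z (k, l)) = 0" if "l \<in> {1..n}" for l
  proof -
    have "vsum n z (Inr l) = 0" using z that unfolding cycle_space_def verts_def by blast
    then show ?thesis by simp
  qed
  have "z (i, j) = (\<Sum>p\<in>Knn n. (c (Inl (fst p)) - c (Inr (snd p))) * z p)"
  proof -
    have "(\<Sum>p\<in>Knn n. (c (Inl (fst p)) - c (Inr (snd p))) * z p) =
        (\<Sum>p\<in>{(i, j)}. (c (Inl (fst p)) - c (Inr (snd p))) * z p)"
    proof (rule sum.mono_neutral_right)
      show "\<forall>p\<in>Knn n - {(i, j)}. (c (Inl (fst p)) - c (Inr (snd p))) * z p = 0"
      proof
        fix p assume "p \<in> Knn n - {(i, j)}"
        then show "(c (Inl (fst p)) - c (Inr (snd p))) * z p = 0"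
          using w[of "fst p" "snd p"] by simp
      qed
    qed (use ij in auto)
    then show ?thesis using nc by (simp add: c_def)
  qed
  also have "\<dots> = (\<Sum>k=1..n. \<Sum>l=1..n. (c (Inl k) - c (Inr l)) * z (k, l))"
    unfolding Knn_def by (simp add: sum.cartesian_product case_prod_beta)
  also have "\<dots> = (\<Sum>k=1..n. c (Inl k) * (\<Sum>l=1..n. z (k, l))) -
      (\<Sum>k=1..n. \<Sum>l=1..n. c (Inr l) * z (k, l))"
    by (simp add: left_diff_distrib sum_subtractf sum_distrib_left)
  also have "(\<Sum>k=1..n. \<Sum>l=1..n. c (Inr l) * z (k, l)) = (\<Sum>l=1..n. c (Inr l) * (\<Sum>k=1..n. z (k, l)))"
    by (subst sum.swap) (simp add: sum_distrib_left)
  also have "\<dots> = 0" by (rule sum.neutral) (use cols in auto)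
  also have "(\<Sum>k=1..n. c (Inl k) * (\<Sum>l=1..n. z (k, l))) = 0"
    by (rule sum.neutral) (use rows in auto)
  finally show ?thesis by simp
qed

text \<open>Alternating signs along a path: bipartiteness makes the signs at both ends depend only on
  the sides of the ends.\<close>

lemma alternating_path:
  assumes G: "G \<subseteq> Knn n" and "(Inl i, v) \<in> (adjacency G)\<^sup>*"
  shows "\<exists>z. (\<forall>e. e \<notin> G \<longrightarrow> z e = 0) \<and>
    (\<forall>u. vsum n z u = of_bool (u = Inl i) - (if isl v then 1 else -1) * of_bool (u = v))"
  using assms(2)
proof (induction rule: rtrancl_induct)
  case base
  show ?case by (intro exI[of _ 0]) (auto simp: vsum_def split: sum.split)
next
  case (step v w)
  from step.IH obtain z where z: "\<And>e. e \<notin> G \<Longrightarrow> z e = 0"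
    "\<And>u. vsum n z u = of_bool (u = Inl i) - (if isl v then 1 else -1) * of_bool (u = v)" by blast
  from step.hyps(2) obtain e where e: "e \<in> G" "ends e = {v, w}" by (auto simp: adjacency_def)
  have eK: "e \<in> Knn n" using e G by auto
  have lr: "isl v \<noteq> isl w" "v \<noteq> w" using e(2) by (auto simp: ends_def doubleton_eq_iff)
  \<comment> \<open>The added multiple of \<open>e\<close> clears the degree at \<open>v\<close> and
    moves it to \<open>w\<close>, which is on the other side and so requires the opposite
    sign.\<close>
  let ?z = "z + (if isl v then 1 else -1) *\<^sub>R indicator {e}"
  have "?z e' = 0" if "e' \<notin> G" for e'
    using z(1)[OF that] that e(1) by (auto simp: indicator_def)
  moreover have "vsum n ?z u = of_bool (u = Inl i) - (if isl w then 1 else -1) * of_bool (u = w)" for u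
    unfolding vsum_linear z(2) vsum_indicator_edge[OF eK] e(2) using lr by auto
  ultimately show ?case by blast
qed

text \<open>The alternating weighting of a path from \<open>Inl i\<close> to \<open>Inr j\<close>
  has degree 1 at both ends and 0 elsewhere; subtracting the new edge closes the path to a
  cycle.\<close>

lemma cycle_space_connected:
  assumes G: "G \<subseteq> Knn n" and ij: "(i, j) \<in> Knn n" "(i, j) \<notin> G"
    and c: "(Inl i, Inr j) \<in> (adjacency G)\<^sup>*"
  shows "\<exists>z\<in>cycle_space n (insert (i, j) G). z (i, j) \<noteq> 0"
proof -
  from alternating_path[OF G c] obtain z where z: "\<And>e. e \<notin> G \<Longrightarrow> z e = 0"
    "\<And>u. vsum n z u = of_bool (u = Inl i) + of_bool (u = Inr j)" by auto
  show ?thesis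
  proof (rule bexI[of _ "z - indicator {(i, j)}"])
    show "(z - indicator {(i, j)}) (i, j) \<noteq> 0" using z(1)[OF ij(2)] by simp
    have "vsum n (z - indicator {(i, j)}) u = 0" for u
      unfolding vsum_linear z(2) vsum_indicator_edge[OF ij(1)] by (auto simp: ends_def)
    then show "z - indicator {(i, j)} \<in> cycle_space n (insert (i, j) G)"
      using z(1) by (auto simp: cycle_space_def indicator_def simp del: vsum_linear vsum_simps)
  qed
qed

text \<open>Edges are added one at a time. An edge inside a component raises both sides by one; an
  edge joining two components changes neither, as one component is lost for one edge gained.\<close>

lemma dim_cycle_space:
  assumes "G \<subseteq> Knn n"
  shows "int (dim (cycle_space n G)) = cyclomatic n G"
proof -
  have "finite G" using assms by (rule finite_subset) simp
  then show ?thesis using assms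
  proof (induction G)
    case empty
    have "cycle_space n {} = {0}"
      by (auto simp: cycle_space_def fun_eq_iff vsum_def split: sum.split)
    moreover have "components n {} = (\<lambda>u. {u}) ` verts n"
      unfolding components_eq by (rule image_cong) (auto simp: component_of_def adjacency_def)
    ultimately show ?case by (simp add: cyclomatic_def card_image dim_zero)
  next
    case (insert e G)
    obtain i j where e: "e = (i, j)" by (cases e)
    have G: "G \<subseteq> Knn n" and eK: "(i, j) \<in> Knn n" and eG: "(i, j) \<notin> G" using insert e by auto
    have ker: "{x \<in> cycle_space n (insert (i, j) G). x (i, j) = 0} = cycle_space n G"
      using eG by (auto simp: cycle_space_def)
    show ?case
    proof (cases "(Inl i, Inr j) \<in> (adjacency G)\<^sup>*")
      case True
      from cycle_space_connected[OF G eK eG True] obtain z where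
        z: "z \<in> cycle_space n (insert (i, j) G)" "z (i, j) \<noteq> 0" by blast
      have "dim (cycle_space n (insert (i, j) G)) = Suc (dim {x \<in> cycle_space n (insert (i, j) G). x (i, j) = 0})"
      proof (rule dim_kernel_functional[OF subspace_cycle_space _ _ linear_apply z(1)])
        show "z (i, j) \<noteq> 0" by (rule z(2))
        show "finite ((\<lambda>e. indicator {e} :: edge \<Rightarrow> real) ` insert (i, j) G)"
          using insert.hyps by simp
        show "cycle_space n (insert (i, j) G) \<subseteq> span ((\<lambda>e. indicator {e}) ` insert (i, j) G)"
          using insert.hyps by (auto simp: cycle_space_def simp del: image_insert intro!: supported_in_span)
      qed
      then show ?thesis
        using insert.IH[OF G] components_insert_connected[OF True, of n] insert.hyps
        by (simp add: e ker cyclomatic_def)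
    next
      case False
      have "cycle_space n (insert (i, j) G) = cycle_space n G"
        using cycle_space_disconnected[OF eK False] ker by blast
      then show ?thesis
        using insert.IH[OF G] card_components_insert_disconnected[OF eK False] insert.hyps
        by (simp add: e cyclomatic_def)
    qed
  qed
qed

section \<open>Dimension of the span of a face\<close>

lemma matching_covered_subset_Knn: "matching_covered n G \<Longrightarrow> G \<subseteq> Knn n"
  unfolding matching_covered_def perfect_matching_def by blast

text \<open>Separates the apex from the other faces; for \<open>n = 0\<close> the empty graph is
  matching-covered.\<close>

lemma matching_covered_nonempty: "n \<ge> 1 \<Longrightarrow> matching_covered n G \<Longrightarrow> G \<noteq> {}"
proof -
  assume n: "n \<ge> 1" and "matching_covered n G"
  then obtain M where M: "M \<subseteq> G" "perfect_matching n M" unfolding matching_covered_def by blast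
  have "Inl 1 \<in> verts n" using n by (auto simp: verts_def)
  then show "G \<noteq> {}" using M unfolding perfect_matching_def by blast
qed

text \<open>The common degree is a functional with kernel \<open>cycle_space n G\<close>, nonzero at
  the indicator of a perfect matching.\<close>

lemma dim_balanced:
  assumes n: "n \<ge> 1" and G: "matching_covered n G"
  shows "int (dim (balanced n G)) = cyclomatic n G + 1"
proof -
  have GK: "G \<subseteq> Knn n" using G by (rule matching_covered_subset_Knn)
  then have fin: "finite G" by (rule finite_subset) simp
  have v1: "Inl 1 \<in> verts n" using n by (auto simp: verts_def)
  obtain M where M: "M \<subseteq> G" "perfect_matching n M" using G unfolding matching_covered_def by blast
  have "dim (balanced n G) = Suc (dim {x \<in> balanced n G. vsum n x (Inl 1) = 0})"
  proof (rule dim_kernel_functional[OF subspace_balanced _ _ linear_vsum])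
    show "finite ((\<lambda>e. indicator {e} :: edge \<Rightarrow> real) ` G)" using fin by simp
    show "balanced n G \<subseteq> span ((\<lambda>e. indicator {e}) ` G)"
      using fin by (auto simp: balanced_def intro!: supported_in_span)
    show "indicator M \<in> balanced n G"
      unfolding balanced_def using vsum_indicator_perfect_matching[OF M(2)] v1 M(1)
      by (auto simp: indicator_def simp del: vsum_simps)
    show "vsum n (indicator M) (Inl 1) \<noteq> 0"
      using vsum_indicator_perfect_matching[OF M(2) v1] by simp
  qed
  also have "{x \<in> balanced n G. vsum n x (Inl 1) = 0} = cycle_space n G"
    unfolding balanced_def cycle_space_def using v1 by (auto simp del: vsum_simps)
  finally show ?thesis using dim_cycle_space[OF GK] by simp
qed

section \<open>Euler's relation for matching-covered subgraphs\<close>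

lemma euler_relation:
  assumes n: "n \<ge> 1" and G: "G \<subseteq> Knn n"
  shows "(\<Sum>H | H \<subseteq> G \<and> matching_covered n H. (-1) powi cyclomatic n H) =
    (of_bool (has_perfect_matching n G) :: real)"
proof (cases "has_perfect_matching n G")
  case False
  have none: "{H. H \<subseteq> G \<and> matching_covered n H} = {}"
    using False unfolding has_perfect_matching_def matching_covered_def by blast
  show ?thesis unfolding none using False by simp
next
  case True
  then obtain M where M: "M \<subseteq> G" "perfect_matching n M" by (auto simp: has_perfect_matching_def)
  define ev where "ev e = (\<lambda>x :: edge \<Rightarrow> real. x e)" for e
  define F where "F = ev ` G"
  define W where "W = balanced n G"
  define C where "C = {x \<in> W. \<forall>f\<in>F. f x \<ge> 0}"
  \<comment> \<open>Coordinates of points of \<open>C\<close> are nonnegative, so a sign vector is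
    the 0/1 indicator of a support, carried over from edges to functionals by
    \<open>ev\<close>.\<close>
  define h where "h H = (\<lambda>f. of_bool (f \<in> ev ` H) :: real)" for H
  define S where "S = {H. H \<subseteq> G \<and> matching_covered n H}"
  have finG: "finite G" using G by (rule finite_subset) simp
  have inj: "ev e = ev e' \<longleftrightarrow> e = e'" for e e'
  proof
    assume "ev e = ev e'"
    then have "ev e (indicator {e}) = ev e' (indicator {e})" by simp
    then show "e = e'" by (simp add: ev_def indicator_def split: if_splits)
  qed simp
  have mem: "ev e \<in> ev ` X \<longleftrightarrow> e \<in> X" for e X
    unfolding image_iff inj by blast
  have C: "C = {x \<in> W. \<forall>e. x e \<ge> 0}"
    by (auto simp: C_def F_def ev_def W_def balanced_def)
  have "M \<noteq> {}"
    using M(2) matching_covered_nonempty[OF n, of M] unfolding matching_covered_def by blast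
  then obtain e where e: "e \<in> M" by blast
  have v1: "Inl 1 \<in> verts n" using n by (auto simp: verts_def)
  have zero: "cell_sum W F C = 0" unfolding C_def
  proof (rule cell_sum_cone)
    show "subspace W" unfolding W_def by (rule subspace_balanced)
    show "finite ((\<lambda>e. indicator {e} :: edge \<Rightarrow> real) ` G)" using finG by simp
    show "W \<subseteq> span ((\<lambda>e. indicator {e}) ` G)"
      using finG by (auto simp: W_def balanced_def intro!: supported_in_span)
    show "finite F" using finG by (simp add: F_def)
    show "linear f" if "f \<in> F" for f using that linear_apply by (auto simp: F_def ev_def)
    show "indicator M \<in> W"
      unfolding W_def balanced_def using vsum_indicator_perfect_matching[OF M(2)] v1 M(1)
      by (auto simp: indicator_def simp del: vsum_simps)
    show "f (indicator M) \<ge> 0" if "f \<in> F" for f using that by (auto simp: F_def ev_def)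
    show "ev e \<in> F" using e M by (auto simp: F_def)
    show "ev e (indicator M) > 0" using e by (simp add: ev_def)
  qed
  have img: "sgn_vec F ` C = h ` insert {} S"
  proof -
    have sv: "sgn_vec F x = h {e. x e > 0}" if "x \<in> C" for x
    proof
      fix f
      have x: "x e \<ge> 0" "e \<notin> G \<Longrightarrow> x e = 0" for e
        using that unfolding C W_def balanced_def by blast+
      show "sgn_vec F x f = h {e. x e > 0} f"
      proof (cases "f \<in> F")
        case True
        then obtain e where e: "e \<in> G" "f = ev e" by (auto simp: F_def)
        then have "f \<in> ev ` {e. x e > 0} \<longleftrightarrow> x e > 0" using mem by simp
        then have "h {e. x e > 0} f = of_bool (x e > 0)" by (simp only: h_def)
        moreover have "sgn_vec F x f = sgn (x e)" using True e(2) by (simp add: sgn_vec_def ev_def)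
        ultimately show ?thesis using x(1)[of e] by (simp add: sgn_real_def)
      next
        case False
        have "{e. x e > 0} \<subseteq> G" using x(2) by (metis (mono_tags) less_irrefl mem_Collect_eq subsetI)
        then have "f \<notin> ev ` {e. x e > 0}" using False unfolding F_def by blast
        then show ?thesis using False by (simp add: sgn_vec_def h_def)
      qed
    qed
    have supp: "(\<lambda>x. {e. x e > 0}) ` C = insert {} S"
    proof (rule set_eqI)
      fix H
      have "H \<in> (\<lambda>x. {e. x e > 0}) ` C \<longleftrightarrow> (\<exists>x\<in>balanced n G. (\<forall>e. x e \<ge> 0) \<and> {e. x e > 0} = H)"
        unfolding C W_def by blast
      then show "H \<in> (\<lambda>x. {e. x e > 0}) ` C \<longleftrightarrow> H \<in> insert {} S"
        unfolding matching_covered_iff_support[OF n G] S_def by blast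
    qed
    show ?thesis unfolding supp[symmetric] image_image by (rule image_cong[OF refl sv])
  qed
  have inj_h: "inj_on h (insert {} S)"
  proof (rule inj_onI)
    fix H K assume "h H = h K"
    then have "h H (ev e) = h K (ev e)" for e by simp
    then have "e \<in> H \<longleftrightarrow> e \<in> K" for e unfolding h_def mem of_bool_eq_iff .
    then show "H = K" by blast
  qed
  have cell: "cell_span W F (h H) = balanced n H" if "H \<subseteq> G" for H
  proof -
    have "h H (ev e) = 0 \<longleftrightarrow> e \<notin> H" for e unfolding h_def mem by simp
    then have "cell_span W F (h H) = {x \<in> W. \<forall>e\<in>G. e \<notin> H \<longrightarrow> x e = 0}"
      by (simp add: cell_span_def F_def ev_def)
    also have "\<dots> = balanced n H" using that unfolding W_def balanced_def by blast
    finally show ?thesis .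
  qed
  have "(\<Sum>H\<in>insert {} S. (-1) ^ dim (balanced n H)) =
      (\<Sum>H\<in>insert {} S. (-1 :: int) ^ dim (cell_span W F (h H)))"
    by (rule sum.cong[OF refl]) (use cell in \<open>auto simp: S_def\<close>)
  also have "\<dots> = cell_sum W F C"
    unfolding cell_sum_def img sum.reindex[OF inj_h] by simp
  finally have "(\<Sum>H\<in>insert {} S. (-1) ^ dim (balanced n H)) = (0 :: int)"
    using zero by simp
  moreover have "finite S" using finG by (simp add: S_def)
  moreover have "{} \<notin> S" using matching_covered_nonempty[OF n] by (auto simp: S_def)
  \<comment> \<open>The apex has dimension 0 and supplies the summand 1.\<close>
  moreover have "balanced n {} = {0}"
    by (auto simp: balanced_def fun_eq_iff vsum_def split: sum.split)
  ultimately have "1 + (\<Sum>H\<in>S. (-1) ^ dim (balanced n H)) = (0 :: int)" by (simp add: dim_zero)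
  then have "real_of_int (1 + (\<Sum>H\<in>S. (-1) ^ dim (balanced n H))) = 0" by (simp only: of_int_0)
  then have "1 + (\<Sum>H\<in>S. (-1) ^ dim (balanced n H)) = (0 :: real)" by simp
  moreover have "(-1) ^ dim (balanced n H) = - ((-1) powi cyclomatic n H :: real)" if "H \<in> S" for H
  proof -
    have "(-1 :: real) ^ dim (balanced n H) = (-1) powi (cyclomatic n H + 1)"
      using dim_balanced[OF n, of H] that by (simp add: S_def flip: power_int_of_nat)
    then show ?thesis by (simp add: power_int_add)
  qed
  ultimately show ?thesis using True by (simp add: S_def sum_negf)
qed

section \<open>Multilinear polynomials\<close>

definition squarefree_monom :: "'v set \<Rightarrow> 'v \<Rightarrow>\<^sub>0 nat" where
  "squarefree_monom A = (\<Sum>v\<in>A. Poly_Mapping.single v 1)"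

lemma lookup_squarefree_monom:
  "finite A \<Longrightarrow> Poly_Mapping.lookup (squarefree_monom A) v = of_bool (v \<in> A)"
  unfolding squarefree_monom_def lookup_sum
  by (subst sum.cong[OF refl, of _ _ "\<lambda>w. if w = v then 1 else 0"])
    (auto simp: lookup_single when_def)

lemma keys_squarefree_monom: "finite A \<Longrightarrow> Poly_Mapping.keys (squarefree_monom A) = A"
  by (auto simp: in_keys_iff lookup_squarefree_monom)

lemma Const_times_prod_Var:
  assumes "finite A"
  shows "Const c * (\<Prod>v\<in>A. Var v) = Poly_Mapping.single (squarefree_monom A) c"
proof -
  have "(\<Prod>v\<in>A. Var v) = Poly_Mapping.single (squarefree_monom A) (1 :: real)"
    using assms
  proof (induction A)
    case empty
    show ?case by (simp add: squarefree_monom_def)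
  next
    case (insert v A)
    then show ?case by (simp add: squarefree_monom_def Var_def mult_single)
  qed
  then show ?thesis by (simp add: Const_def mult_single)
qed

lemma multilinear_in_iff:
  assumes "finite V"
  shows "multilinear_in V p \<longleftrightarrow> Poly_Mapping.keys p \<subseteq> squarefree_monom ` Pow V"
proof -
  have "Poly_Mapping.keys m \<subseteq> V \<and> (\<forall>v. Poly_Mapping.lookup m v \<le> 1) \<longleftrightarrow>
      m \<in> squarefree_monom ` Pow V" for m
  proof
    assume m: "Poly_Mapping.keys m \<subseteq> V \<and> (\<forall>v. Poly_Mapping.lookup m v \<le> 1)"
    have "m = squarefree_monom (Poly_Mapping.keys m)"
    proof (rule poly_mapping_eqI)
      fix v
      have "Poly_Mapping.lookup m v \<le> 1" using m by blast
      then show "Poly_Mapping.lookup m v = Poly_Mapping.lookup (squarefree_monom (Poly_Mapping.keys m)) v"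
        by (cases "Poly_Mapping.lookup m v") (auto simp: lookup_squarefree_monom in_keys_iff)
    qed
    then show "m \<in> squarefree_monom ` Pow V" using m by blast
  next
    assume "m \<in> squarefree_monom ` Pow V"
    then obtain A where A: "A \<subseteq> V" "m = squarefree_monom A" by blast
    have "finite A" using A assms finite_subset by blast
    then show "Poly_Mapping.keys m \<subseteq> V \<and> (\<forall>v. Poly_Mapping.lookup m v \<le> 1)"
      using A by (simp add: keys_squarefree_monom lookup_squarefree_monom)
  qed
  then show ?thesis unfolding multilinear_in_def by blast
qed

lemma inj_on_squarefree_monom: "finite V \<Longrightarrow> inj_on squarefree_monom (Pow V)"
  by (rule inj_onI) (metis PowD finite_subset keys_squarefree_monom)

lemma eval_multilinear:
  assumes V: "finite V" and p: "multilinear_in V p"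
  shows "eval_poly p x = (\<Sum>A\<in>Pow V. Poly_Mapping.lookup p (squarefree_monom A) * (\<Prod>v\<in>A. x v))"
proof -
  let ?t = "\<lambda>m. Poly_Mapping.lookup p m * (\<Prod>v\<in>Poly_Mapping.keys m. x v ^ Poly_Mapping.lookup m v)"
  have "eval_poly p x = (\<Sum>m\<in>squarefree_monom ` Pow V. ?t m)"
    unfolding eval_poly_def using p V
    by (intro sum.mono_neutral_left) (auto simp: multilinear_in_iff in_keys_iff)
  also have "\<dots> = (\<Sum>A\<in>Pow V. ?t (squarefree_monom A))"
    using inj_on_squarefree_monom[OF V] by (simp add: sum.reindex)
  also have "\<dots> = (\<Sum>A\<in>Pow V. Poly_Mapping.lookup p (squarefree_monom A) * (\<Prod>v\<in>A. x v))"
  proof (rule sum.cong[OF refl])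
    fix A assume "A \<in> Pow V"
    then have "finite A" using V finite_subset by blast
    then show "?t (squarefree_monom A) = Poly_Mapping.lookup p (squarefree_monom A) * (\<Prod>v\<in>A. x v)"
      by (simp add: keys_squarefree_monom lookup_squarefree_monom)
  qed
  finally show ?thesis .
qed

text \<open>The uniqueness half of Moebius inversion: by induction all terms of proper subsets
  cancel.\<close>

lemma subset_sums_determine:
  fixes a b :: "'v set \<Rightarrow> real"
  assumes "finite A" "\<And>B. B \<subseteq> A \<Longrightarrow> (\<Sum>C\<in>Pow B. a C) = (\<Sum>C\<in>Pow B. b C)"
  shows "a A = b A"
  using assms
proof (induction A rule: finite_psubset_induct)
  case (psubset A)
  have "a C = b C" if "C \<in> Pow A - {A}" for C
    by (rule psubset.IH) (use that psubset.prems in auto)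
  then have "(\<Sum>C\<in>Pow A - {A}. a C) = (\<Sum>C\<in>Pow A - {A}. b C)" by (rule sum.cong[OF refl])
  moreover have "(\<Sum>C\<in>Pow A. c C) = c A + (\<Sum>C\<in>Pow A - {A}. c C)" for c :: "'v set \<Rightarrow> real"
    using psubset.hyps by (intro sum.remove) auto
  ultimately show ?case using psubset.prems[of A] by simp
qed

text \<open>At the 0/1 point of \<open>S\<close> a squarefree monomial is 1 exactly when its
  variables lie in \<open>S\<close>, so a multilinear polynomial takes as value there the sum of its
  coefficients over subsets of \<open>S\<close>. Values on the cube and coefficients thus determine
  each other, and only the subset sums of \<open>a\<close> need checking.\<close>

lemma multilinear_represents_iff:
  fixes p :: "'v rpoly"
  assumes V: "finite V"
    and a: "\<And>S. S \<subseteq> V \<Longrightarrow> (\<Sum>A\<in>Pow S. a A) = f (\<lambda>v\<in>V. indicator S v)"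
  shows "multilinear_in V p \<and> represents_on (V \<rightarrow>\<^sub>E {0, 1}) p f \<longleftrightarrow>
    p = (\<Sum>A\<in>Pow V. Const (a A) * (\<Prod>v\<in>A. Var v))"
proof -
  define q :: "'v rpoly" where "q = (\<Sum>A\<in>Pow V. Const (a A) * (\<Prod>v\<in>A. Var v))"
  have q: "q = (\<Sum>A\<in>Pow V. Poly_Mapping.single (squarefree_monom A) (a A))"
    unfolding q_def by (rule sum.cong[OF refl], rule Const_times_prod_Var) (use V finite_subset in blast)
  have lq: "Poly_Mapping.lookup q (squarefree_monom A) = a A" if "A \<subseteq> V" for A
  proof -
    have "Poly_Mapping.lookup q (squarefree_monom A) =
        (\<Sum>B\<in>Pow V. if B = A then a B else 0)"
      unfolding q lookup_sum
      by (rule sum.cong[OF refl])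
        (use inj_on_squarefree_monom[OF V] that in \<open>auto simp: lookup_single when_def dest: inj_onD\<close>)
    then show ?thesis using that V by simp
  qed
  have mq: "multilinear_in V q"
    unfolding multilinear_in_iff[OF V] q
    by (rule order_trans[OF keys_sum]) (auto split: if_splits)
  have ind: "(\<lambda>v\<in>V. indicator S v :: real) \<in> V \<rightarrow>\<^sub>E {0, 1}" for S
    by (auto simp: indicator_def)
  have eval: "eval_poly r (\<lambda>v\<in>V. indicator S v) = (\<Sum>A\<in>Pow S. Poly_Mapping.lookup r (squarefree_monom A))"
    if r: "multilinear_in V r" and S: "S \<subseteq> V" for r S
  proof -
    have "(\<Prod>v\<in>A. (\<lambda>v\<in>V. indicator S v :: real) v) = of_bool (A \<subseteq> S)" if "A \<subseteq> V" for A
    proof -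
      have "finite A" using that V finite_subset by blast
      moreover have "(\<Prod>v\<in>A. (\<lambda>v\<in>V. indicator S v :: real) v) = (\<Prod>v\<in>A. indicator S v)"
        by (rule prod.cong) (use that in auto)
      ultimately show ?thesis by (auto simp: indicator_def intro!: prod.neutral)
    qed
    then have "eval_poly r (\<lambda>v\<in>V. indicator S v) =
        (\<Sum>A\<in>Pow V. if A \<subseteq> S then Poly_Mapping.lookup r (squarefree_monom A) else 0)"
      unfolding eval_multilinear[OF V r] by (intro sum.cong) auto
    also have "\<dots> = (\<Sum>A\<in>Pow S. if A \<subseteq> S then Poly_Mapping.lookup r (squarefree_monom A) else 0)"
      using V S by (intro sum.mono_neutral_right) auto
    finally show ?thesis by (auto intro: sum.cong)
  qed
  \<comment> \<open>Points of the cube are \<open>undefined\<close> off \<open>V\<close>, hence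
    restricted indicators.\<close>
  have cube: "\<exists>S\<subseteq>V. x = (\<lambda>v\<in>V. indicator S v)" if "x \<in> V \<rightarrow>\<^sub>E {0, 1 :: real}" for x
    using that by (intro exI[of _ "{v \<in> V. x v = 1}"]) (auto simp: fun_eq_iff PiE_iff indicator_def extensional_def)
  have rep: "represents_on (V \<rightarrow>\<^sub>E {0, 1}) r f \<longleftrightarrow>
      (\<forall>S\<subseteq>V. (\<Sum>A\<in>Pow S. Poly_Mapping.lookup r (squarefree_monom A)) = (\<Sum>A\<in>Pow S. a A))"
    if "multilinear_in V r" for r
    unfolding represents_on_def using eval[OF that] a ind cube by metis
  have "represents_on (V \<rightarrow>\<^sub>E {0, 1}) q f"
    unfolding rep[OF mq] using lq by (auto intro!: sum.cong)
  moreover have "p = q" if p: "multilinear_in V p" "represents_on (V \<rightarrow>\<^sub>E {0, 1}) p f"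
  proof (rule poly_mapping_eqI)
    fix m
    show "Poly_Mapping.lookup p m = Poly_Mapping.lookup q m"
    proof (cases "m \<in> squarefree_monom ` Pow V")
      case True
      then obtain A where A: "A \<subseteq> V" "m = squarefree_monom A" by blast
      have "Poly_Mapping.lookup p (squarefree_monom A) = a A"
        by (rule subset_sums_determine) (use p A V rep[OF p(1)] in \<open>auto intro: finite_subset\<close>)
      then show ?thesis using A lq by simp
    next
      case False
      then have "m \<notin> Poly_Mapping.keys p" "m \<notin> Poly_Mapping.keys q"
        using p(1) mq multilinear_in_iff[OF V] by blast+
      then show ?thesis by (simp add: in_keys_iff)
    qed
  qed
  ultimately show ?thesis using mq unfolding q_def[symmetric] by blast
qed

theorem theorem1:
  fixes n :: nat
  assumes "n \<ge> 1"
  shows "\<forall>p :: edge rpoly.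
           multilinear_in (Knn n) p \<and> represents_on (cube n) p (BPM n) \<longleftrightarrow>
           p = (\<Sum>G\<in>Pow (Knn n). Const (bpm_coeff n G) * (\<Prod>e\<in>G. Var e))"
proof
  fix p :: "edge rpoly"
  show "multilinear_in (Knn n) p \<and> represents_on (cube n) p (BPM n) \<longleftrightarrow>
      p = (\<Sum>G\<in>Pow (Knn n). Const (bpm_coeff n G) * (\<Prod>e\<in>G. Var e))"
    unfolding cube_def
  proof (rule multilinear_represents_iff)
    fix S assume S: "S \<subseteq> Knn n"
    then have fin: "finite S" by (rule finite_subset) simp
    \<comment> \<open>Dropping the zero coefficients leaves the sum in Euler's relation for the
      graph \<open>S\<close>.\<close>
    have "(\<Sum>A\<in>Pow S. bpm_coeff n A) =
        (\<Sum>H | H \<subseteq> S \<and> matching_covered n H. (-1) powi cyclomatic n H)"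
      using fin by (intro sum.mono_neutral_cong_right) (auto simp: bpm_coeff_def)
    also have "\<dots> = of_bool (has_perfect_matching n S)"
      by (rule euler_relation[OF assms S])
    also have "\<dots> = BPM n (\<lambda>v\<in>Knn n. indicator S v)"
    proof -
      have "{e \<in> Knn n. (\<lambda>v\<in>Knn n. indicator S v :: real) e = 1} = S"
        using S by (auto simp: indicator_def)
      then show ?thesis unfolding BPM_def by (simp only: of_bool_def)
    qed
    finally show "(\<Sum>A\<in>Pow S. bpm_coeff n A) = BPM n (\<lambda>v\<in>Knn n. indicator S v)" .
  qed simp
qed

end
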